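(* Let $\operatorname{SPD}(n)$ be the manifold of symmetric positive-definite real $n\times n$ matrices endowed with the affine-invariant Riemannian metric $\langle X,Y\rangle_x=\operatorname{Tr}(x^{-1}Xx^{-1}Y)$. Let $\mathcal{N}$ be a nonempty geodesically complete, geodesically convex submanifold of $\operatorname{SPD}(n)$. Then there exist $x\in\operatorname{SPD}(n)$ and a linear subspace $E\subset\operatorname{Sym}(n)$ satisfying $[X,[X,Y]]\in E$ for all $X,Y\in E$, such that $$\mathcal{N}=x\cdot\exp(E)\cdot x=\{x\,\exp(u)\,x : u\in E\}.$$
   Context: $\operatorname{Sym}(n)$ is the vector space of symmetric $n\times n$ real matrices, identified with the tangent space of $\operatorname{SPD}(n)$ at each point; $[A,B]=AB-BA$; $\exp$ is the matrix exponential. A submanifold $\mathcal{N}$ (without boundary) of a Riemannian manifold $\mathcal{M}$ is geodesically convex if for any two points of $\mathcal{N}$ there exists a unique minimizing geodesic of $\mathcal{M}$ connecting them and it is entirely contained in $\mathcal{N}$. Geodesically complete means that, for the induced Riemannian metric, every geodesic of $\mathcal{N}$ extends to a geodesic of $\mathcal{N}$ defined on all of $\mathbb{R}$. *)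

theory Defs
  imports "HOL-Analysis.Analysis"
begin

text \<open>
  All matrix sets and curves live in the Euclidean space \<open>real^'n^'n\<close>. Note that \<open>*\<close>, \<open>^\<close> and
  \<open>1\<close> act componentwise on this type; matrix multiplication is \<open>**\<close> and the unit is \<open>mat 1\<close>.
\<close>

definition Sym :: "(real^'n^'n) set" where
  "Sym = {A. transpose A = A}"

definition SPD :: "(real^'n^'n) set" where
  "SPD = {A \<in> Sym. \<forall>v. v \<noteq> 0 \<longrightarrow> v \<bullet> (A *v v) > 0}"

definition commutator :: "real^'n^'n \<Rightarrow> real^'n^'n \<Rightarrow> real^'n^'n" where
  "commutator A B = A ** B - B ** A"

primrec mat_power :: "real^'n^'n \<Rightarrow> nat \<Rightarrow> real^'n^'n" where
  "mat_power A 0 = mat 1"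
| "mat_power A (Suc k) = A ** mat_power A k"

definition mat_exp :: "real^'n^'n \<Rightarrow> real^'n^'n" where
  "mat_exp A = (\<Sum>k. (1 / fact k) *\<^sub>R mat_power A k)"

text \<open>The affine-invariant metric at the point \<open>x\<close>.\<close>

definition metric :: "real^'n^'n \<Rightarrow> real^'n^'n \<Rightarrow> real^'n^'n \<Rightarrow> real" where
  "metric x X Y = trace (matrix_inv x ** X ** matrix_inv x ** Y)"


section \<open>Smooth maps\<close>

text \<open>Class \<open>C\<^sup>k\<close>; intended for open sets only.\<close>

primrec Ck_on ::
  "nat \<Rightarrow> 'a::euclidean_space set \<Rightarrow> ('a \<Rightarrow> 'b::euclidean_space) \<Rightarrow> bool" where
  "Ck_on 0 W f \<longleftrightarrow> continuous_on W f"
| "Ck_on (Suc k) W f \<longleftrightarrow>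
     (\<forall>x\<in>W. f differentiable (at x)) \<and>
     (\<forall>v. Ck_on k W (\<lambda>x. frechet_derivative f (at x) v))"

text \<open>
  Smoothness on an arbitrary subset of a Euclidean space, by local smooth extension. It is used for
  relatively open subsets of \<open>Sym\<close> and for intervals, possibly with end points.
\<close>

definition smooth_on :: "'a::euclidean_space set \<Rightarrow> ('a \<Rightarrow> 'b::euclidean_space) \<Rightarrow> bool" where
  "smooth_on S f \<longleftrightarrow>
     (\<forall>x\<in>S. \<exists>W g. open W \<and> x \<in> W \<and> (\<forall>k. Ck_on k W g) \<and> (\<forall>y\<in>S \<inter> W. g y = f y))"


section \<open>Submanifolds of \<open>SPD\<close>\<close>

text \<open>
  \<open>\<phi> : U \<rightarrow> V\<close> is a chart of the manifold \<open>SPD\<close>, modelled on the vector space \<open>Sym\<close>, with inverse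
  \<open>\<psi>\<close>; it flattens \<open>N \<inter> U\<close> onto the relatively open piece \<open>V \<inter> L\<close> of the linear subspace \<open>L\<close>. Thus
  the restriction of \<open>\<phi>\<close> to \<open>N \<inter> U\<close> is a chart of \<open>N\<close>, modelled on \<open>L\<close>. For \<open>N = SPD\<close> and \<open>U\<close>
  nonempty this forces \<open>L = Sym\<close>, and one gets precisely the charts of \<open>SPD\<close>.
\<close>

definition slice_chart ::
  "(real^'n^'n) set \<Rightarrow> (real^'n^'n) set \<Rightarrow> (real^'n^'n) set \<Rightarrow>
   (real^'n^'n \<Rightarrow> real^'n^'n) \<Rightarrow> (real^'n^'n \<Rightarrow> real^'n^'n) \<Rightarrow> (real^'n^'n) set \<Rightarrow> bool" where
  "slice_chart N U V \<phi> \<psi> L \<longleftrightarrow>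
     U \<subseteq> SPD \<and> openin (top_of_set Sym) U \<and> openin (top_of_set Sym) V \<and>
     homeomorphism U V \<phi> \<psi> \<and> smooth_on U \<phi> \<and> smooth_on V \<psi> \<and>
     subspace L \<and> L \<subseteq> Sym \<and> \<phi> ` (N \<inter> U) = V \<inter> L"

definition submanifold :: "(real^'n^'n) set \<Rightarrow> bool" where
  "submanifold N \<longleftrightarrow>
     N \<subseteq> SPD \<and>
     (\<exists>k. \<forall>p\<in>N. \<exists>U V \<phi> \<psi> L. slice_chart N U V \<phi> \<psi> L \<and> p \<in> U \<and> dim L = k)"


section \<open>Geodesics of a submanifold for the induced metric\<close>

text \<open>
  The induced metric in the local parametrization \<open>\<psi>\<close> of a submanifold, as a function of the point
  \<open>w \<in> V \<inter> L\<close> and of tangent vectors \<open>a, b \<in> L\<close>.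
\<close>

definition local_metric ::
  "(real^'n^'n \<Rightarrow> real^'n^'n) \<Rightarrow> real^'n^'n \<Rightarrow> real^'n^'n \<Rightarrow> real^'n^'n \<Rightarrow> real" where
  "local_metric \<psi> w a b =
     (let d = (\<lambda>v. vector_derivative (\<lambda>t. \<psi> (w + t *\<^sub>R v)) (at 0))
      in metric (\<psi> w) (d a) (d b))"

definition metric_deriv ::
  "('a::real_vector \<Rightarrow> 'a \<Rightarrow> 'a \<Rightarrow> real) \<Rightarrow> 'a \<Rightarrow> 'a \<Rightarrow> 'a \<Rightarrow> 'a \<Rightarrow> real" where
  "metric_deriv h w v a b = deriv (\<lambda>t. h (w + t *\<^sub>R v) a b) 0"

text \<open>
  Christoffel symbols of the first kind of the Levi-Civita connection of a metric \<open>h\<close> on an open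
  subset of a vector space: Koszul's formula for \<open>h(\<nabla>\<^sub>a b, z)\<close> with constant vector fields.
\<close>

definition christoffel ::
  "('a::real_vector \<Rightarrow> 'a \<Rightarrow> 'a \<Rightarrow> real) \<Rightarrow> 'a \<Rightarrow> 'a \<Rightarrow> 'a \<Rightarrow> 'a \<Rightarrow> real" where
  "christoffel h w a b z =
     (metric_deriv h w a b z + metric_deriv h w b a z - metric_deriv h w z a b) / 2"

text \<open>
  A geodesic of \<open>N\<close> is a smooth curve \<open>\<gamma>\<close> in \<open>N\<close> with \<open>\<nabla>\<^sub>\<gamma>\<^sub>' \<gamma>' = 0\<close>, where \<open>\<nabla>\<close> is the Levi-Civita
  connection of the induced metric of \<open>N\<close>: in each chart of \<open>N\<close> it satisfies the geodesic equation,
  here tested against all tangent vectors \<open>z\<close>. The interval \<open>I\<close> has more than one point but may be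
  open, closed or half-open, bounded or not; derivatives are one-sided at its end points. Values of
  \<open>\<gamma>\<close> outside \<open>I\<close> are irrelevant.
\<close>

definition geodesic :: "(real^'n^'n) set \<Rightarrow> real set \<Rightarrow> (real \<Rightarrow> real^'n^'n) \<Rightarrow> bool" where
  "geodesic N I \<gamma> \<longleftrightarrow>
     is_interval I \<and> interior I \<noteq> {} \<and> \<gamma> ` I \<subseteq> N \<and> smooth_on I \<gamma> \<and>
     (\<forall>U V \<phi> \<psi> L. slice_chart N U V \<phi> \<psi> L \<longrightarrow>
        (\<forall>t\<in>I. \<gamma> t \<in> U \<longrightarrow>
           (let h = local_metric \<psi>;
                c = \<phi> \<circ> \<gamma>;
                c' = (\<lambda>s. vector_derivative c (at s within I));
                c'' = (\<lambda>s. vector_derivative c' (at s within I))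
            in \<forall>z\<in>L. h (c t) (c'' t) z + christoffel h (c t) (c' t) (c' t) z = 0)))"

definition geodesically_complete :: "(real^'n^'n) set \<Rightarrow> bool" where
  "geodesically_complete N \<longleftrightarrow>
     (\<forall>I \<gamma>. geodesic N I \<gamma> \<longrightarrow> (\<exists>\<beta>. geodesic N UNIV \<beta> \<and> (\<forall>t\<in>I. \<beta> t = \<gamma> t)))"


section \<open>Minimizing geodesics of \<open>SPD\<close> and geodesic convexity\<close>

definition piecewise_smooth :: "(real \<Rightarrow> real^'n^'n) \<Rightarrow> bool" where
  "piecewise_smooth \<sigma> \<longleftrightarrow>
     (\<exists>(m::nat) a. a 0 = 0 \<and> a m = 1 \<and>
        (\<forall>i<m. a i < a (Suc i) \<and> smooth_on {a i..a (Suc i)} \<sigma>))"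

text \<open>
  For a piecewise smooth curve the integrand is bounded and continuous off a finite set, so the
  integral exists; the value of \<open>vector_derivative\<close> at the break points is irrelevant.
\<close>

definition curve_length :: "(real \<Rightarrow> real^'n^'n) \<Rightarrow> real" where
  "curve_length \<sigma> =
     integral {0..1} (\<lambda>t. let v = vector_derivative \<sigma> (at t within {0..1})
                          in sqrt (metric (\<sigma> t) v v))"

definition minimizing_geodesic ::
  "real^'n^'n \<Rightarrow> real^'n^'n \<Rightarrow> (real \<Rightarrow> real^'n^'n) \<Rightarrow> bool" where
  "minimizing_geodesic p q \<gamma> \<longleftrightarrow>
     geodesic SPD {0..1} \<gamma> \<and> \<gamma> 0 = p \<and> \<gamma> 1 = q \<and>
     (\<forall>\<sigma>. piecewise_smooth \<sigma> \<and> \<sigma> ` {0..1} \<subseteq> SPD \<and> \<sigma> 0 = p \<and> \<sigma> 1 = q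
        \<longrightarrow> curve_length \<gamma> \<le> curve_length \<sigma>)"

text \<open>
  Geodesics carry an affine parametrization, which the interval \<open>{0..1}\<close> makes unique; so
  uniqueness means equality of the curves on \<open>{0..1}\<close>.
\<close>

definition geodesically_convex :: "(real^'n^'n) set \<Rightarrow> bool" where
  "geodesically_convex N \<longleftrightarrow>
     (\<forall>p\<in>N. \<forall>q\<in>N. \<exists>\<gamma>. minimizing_geodesic p q \<gamma> \<and> \<gamma> ` {0..1} \<subseteq> N \<and>
        (\<forall>\<beta>. minimizing_geodesic p q \<beta> \<longrightarrow> (\<forall>t\<in>{0..1}. \<beta> t = \<gamma> t)))"

end

theory Submission
  imports Defs
begin

text \<open>
  In the identity chart the geodesic equation of \<open>SPD\<close> reads \<open>\<gamma>'' = \<gamma>' \<gamma>\<^sup>-\<^sup>1 \<gamma>'\<close>, so the geodesics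
  from \<open>x\<^sup>2\<close> are the curves \<open>x exp(tC) x\<close> with \<open>C\<close> symmetric. Convexity makes the second fundamental
  form of \<open>N\<close> vanish; hence the geodesics of \<open>N\<close> are geodesics of \<open>SPD\<close>, and by completeness any two
  points of \<open>N\<close> lie on a full geodesic \<open>x exp(\<real>C) x \<subseteq> N\<close>. Consequently \<open>M = x\<^sup>-\<^sup>1 N x\<^sup>-\<^sup>1\<close> contains \<open>1\<close> and
  is closed under the geodesic symmetries \<open>(P, Q) \<mapsto> P Q\<^sup>-\<^sup>1 P\<close>, and \<open>M = exp(E)\<close> for the set \<open>E\<close> of all
  symmetric \<open>X\<close> with \<open>exp(\<real>X) \<subseteq> M\<close>. The set \<open>E\<close> is closed, and expanding
  \<open>exp(sX) exp(2sY) exp(sX) = exp(Z\<^sub>s)\<close> to second order shows that \<open>E\<close> is a linear subspace and a Lie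
  triple system.
\<close>


section \<open>Matrices\<close>

text \<open>Convexity supplies only segments, and completeness prolongs them only as geodesics for
  the induced connection of \<open>N\<close>. The vanishing second fundamental form identifies the
  prolonged curve with x exp(tC) x and so puts whole lines into \<open>M\<close>; the algebra of
  \<open>M\<close> rests on these lines. Since \<open>M\<close> is closed under P Q P but in general
  not under products, sums and brackets have to be extracted from palindromes. The logarithm of
  exp(sX) exp(2sY) exp(sX) has no term in s^2, so it yields X + Y but no bracket. With g = exp(sX)
  exp(sY) this palindrome is g g^T, and the bracket sits in the rotation k of the polar
  decomposition g = exp(Z/2) k. Conjugation by k acts on exponentials as a composition of
  palindromes, hence preserves \<open>E\<close>, and its second-order term is the action of [X,Y]/2.
  Defining \<open>E\<close> by full lines instead of logarithms makes it stable under scaling from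
  the start, and its closedness turns limits of difference quotients into elements of
  \<open>E\<close>.\<close>

interpretation matrix_mult: bounded_bilinear "(**) :: real^'n^'n \<Rightarrow> real^'n^'n \<Rightarrow> real^'n^'n"
  by (auto simp: bilinear_conv_bounded_bilinear[symmetric] bilinear_def linear_iff
      matrix_add_ldistrib matrix_matrix_mult_def vec_eq_iff algebra_simps sum.distrib sum_distrib_left)

lemma bounded_linear_transpose: "bounded_linear (transpose :: real^'n^'n \<Rightarrow> real^'n^'n)"
  by (auto simp: linear_conv_bounded_linear[symmetric] linear_iff transpose_def vec_eq_iff)

lemmas transpose_linear_simps =
  linear_simps[OF bounded_linear_transpose]

lemmas matrix_simps = matrix_mult.add_left matrix_mult.add_right matrix_mult.diff_left
  matrix_mult.diff_right matrix_mult.scaleR_left matrix_mult.scaleR_right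
  matrix_mult.minus_left matrix_mult.minus_right

lemma trace_eq_inner: "trace (A ** B) = transpose A \<bullet> (B :: real^'n^'n)"
  unfolding trace_def matrix_matrix_mult_def transpose_def inner_vec_def
  by simp (rule sum.swap)

lemma bounded_linear_trace: "bounded_linear (trace :: real^'n^'n \<Rightarrow> real)"
  by (auto simp: linear_conv_bounded_linear[symmetric] linear_iff trace_def sum.distrib sum_distrib_left)

lemma subspace_Sym: "subspace Sym"
  by (auto simp: subspace_def Sym_def transpose_linear_simps)

section \<open>Continuity and derivative of matrix inversion\<close>

lemma tendsto_det:
  fixes f :: "'a \<Rightarrow> real^'n^'n"
  assumes "(f \<longlongrightarrow> A) F"
  shows "((\<lambda>s. det (f s)) \<longlongrightarrow> det A) F"
  unfolding det_def using assms by (intro tendsto_intros)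

lemma matrix_inv:
  fixes A :: "real^'n^'n"
  assumes "invertible A"
  shows matrix_inv_right: "A ** matrix_inv A = mat 1"
    and matrix_inv_left: "matrix_inv A ** A = mat 1"
  using someI_ex[OF assms[unfolded invertible_def]] by (simp_all add: matrix_inv_def)

text \<open>Cramer's rule: as quotients of determinants, the entries of the inverse inherit their
  continuity from \<open>det\<close>.\<close>

lemma matrix_inv_entry:
  fixes A :: "real^'n^'n"
  assumes "invertible A"
  shows "matrix_inv A $ k $ l = det (\<chi> i j. if j = k then axis l 1 $ i else A $ i $ j) / det A"
proof -
  have "A *v (matrix_inv A *v axis l 1) = axis l 1"
    using assms by (simp add: matrix_vector_mul_assoc matrix_inv_right)
  moreover have "det A \<noteq> 0"
    using assms by (simp add: invertible_det_nz)
  ultimately have "matrix_inv A *v axis l 1 =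
      (\<chi> k. det (\<chi> i j. if j = k then axis l 1 $ i else A $ i $ j) / det A)"
    using cramer by blast
  moreover have "(matrix_inv A *v axis l 1) $ k = matrix_inv A $ k $ l"
    by (simp add: matrix_vector_mult_basis column_def)
  ultimately show ?thesis by simp
qed

lemma eventually_invertible:
  fixes f :: "'a \<Rightarrow> real^'n^'n"
  assumes "(f \<longlongrightarrow> A) F" "invertible A"
  shows "\<forall>\<^sub>F s in F. invertible (f s)"
  using tendsto_imp_eventually_ne[OF tendsto_det[OF assms(1)], of 0] assms(2)
  by (simp add: invertible_det_nz)

lemma tendsto_matrix_inv:
  fixes f :: "'a \<Rightarrow> real^'n^'n"
  assumes "(f \<longlongrightarrow> A) F" "invertible A"
  shows "((\<lambda>s. matrix_inv (f s)) \<longlongrightarrow> matrix_inv A) F"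
proof (intro vec_tendstoI)
  fix k l
  have nz: "det A \<noteq> 0"
    using assms(2) by (simp add: invertible_det_nz)
  have "((\<lambda>s. (\<chi> i j. if j = k then axis l 1 $ i else f s $ i $ j)) \<longlongrightarrow>
      (\<chi> i j. if j = k then axis l 1 $ i else A $ i $ j)) F"
    by (intro vec_tendstoI) (auto intro!: tendsto_vec_nth assms)
  then have "((\<lambda>s. det (\<chi> i j. if j = k then axis l 1 $ i else f s $ i $ j) / det (f s)) \<longlongrightarrow>
      matrix_inv A $ k $ l) F"
    unfolding matrix_inv_entry[OF assms(2)]
    by (intro tendsto_divide tendsto_det assms(1) nz)
  then show "((\<lambda>s. matrix_inv (f s) $ k $ l) \<longlongrightarrow> matrix_inv A $ k $ l) F"
    by (rule Lim_transform_eventually)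
      (use eventually_invertible[OF assms] in eventually_elim, simp add: matrix_inv_entry)
qed

lemma matrix_inv_unique:
  fixes A B :: "real^'n^'n"
  assumes "A ** B = mat 1"
  shows "matrix_inv A = B" "invertible A"
proof -
  show *: "invertible A"
    using assms matrix_left_right_inverse unfolding invertible_def by blast
  have "matrix_inv A = matrix_inv A ** (A ** B)" using assms by simp
  also have "\<dots> = B"
    unfolding matrix_mul_assoc by (simp add: matrix_inv_left *)
  finally show "matrix_inv A = B" .
qed

text \<open>The slope form turns derivatives into plain limits, which can be taken entrywise and
  inside closed sets.\<close>

lemma has_vector_derivative_iff_slope:
  fixes f :: "real \<Rightarrow> 'a::real_normed_vector"
  shows "(f has_vector_derivative f') (at t within S) \<longleftrightarrow>
    ((\<lambda>s. (f s - f t) /\<^sub>R (s - t)) \<longlongrightarrow> f') (at t within S)"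
proof -
  have "norm (f s - f t - (s - t) *\<^sub>R f') / norm (s - t) = norm ((f s - f t) /\<^sub>R (s - t) - f')"
    if "s \<noteq> t" for s
  proof -
    have "(f s - f t) /\<^sub>R (s - t) - f' = (f s - f t - (s - t) *\<^sub>R f') /\<^sub>R (s - t)"
      using that by (simp add: scaleR_diff_right)
    then show ?thesis by (simp add: divide_inverse)
  qed
  then have "((\<lambda>s. norm (f s - f t - (s - t) *\<^sub>R f') / norm (s - t)) \<longlongrightarrow> 0) (at t within S) \<longleftrightarrow>
     ((\<lambda>s. norm ((f s - f t) /\<^sub>R (s - t) - f')) \<longlongrightarrow> 0) (at t within S)"
    by (intro Lim_cong_within) auto
  then show ?thesis
    by (simp add: has_vector_derivative_def has_derivative_iff_norm tendsto_norm_zero_iff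
        LIM_zero_iff bounded_linear_scaleR_left)
qed

text \<open>The resolvent identity \<open>matrix_inv A - matrix_inv B = - (matrix_inv A ** (A - B)
  ** matrix_inv B)\<close> writes the slope of the inverse through the slope of \<open>f\<close>;
  continuity of inversion then gives the limit.\<close>

lemma has_vector_derivative_matrix_inv:
  fixes f :: "real \<Rightarrow> real^'n^'n"
  assumes f: "(f has_vector_derivative f') (at t within S)" and inv: "invertible (f t)"
  shows "((\<lambda>s. matrix_inv (f s)) has_vector_derivative
    - (matrix_inv (f t) ** f' ** matrix_inv (f t))) (at t within S)"
proof -
  have lim: "(f \<longlongrightarrow> f t) (at t within S)"
    using f has_vector_derivative_continuous continuous_within by blast
  have "((\<lambda>s. - (matrix_inv (f s) ** ((f s - f t) /\<^sub>R (s - t)) ** matrix_inv (f t))) \<longlongrightarrow>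
      - (matrix_inv (f t) ** f' ** matrix_inv (f t))) (at t within S)"
    using f unfolding has_vector_derivative_iff_slope
    by (intro tendsto_minus matrix_mult.tendsto tendsto_matrix_inv lim inv tendsto_const)
  then show ?thesis
    unfolding has_vector_derivative_iff_slope
  proof (rule Lim_transform_eventually)
    show "\<forall>\<^sub>F s in at t within S. - (matrix_inv (f s) ** ((f s - f t) /\<^sub>R (s - t)) ** matrix_inv (f t)) =
      (matrix_inv (f s) - matrix_inv (f t)) /\<^sub>R (s - t)"
      using eventually_invertible[OF lim inv]
    proof eventually_elim
      case (elim s)
      have "matrix_inv (f s) ** (f s - f t) ** matrix_inv (f t) = matrix_inv (f t) - matrix_inv (f s)"
        by (simp add: matrix_simps matrix_inv_left elim matrix_mul_assoc[symmetric] matrix_inv_right inv)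
      then show ?case
        by (simp add: matrix_simps flip: scaleR_minus_right)
    qed
  qed
qed

text \<open>Product rule; the two negative terms come from the two inverse factors of the
  metric.\<close>

lemma has_vector_derivative_metric:
  fixes P A B :: "real \<Rightarrow> real^'n^'n"
  assumes "(P has_vector_derivative P') (at t within S)" "(A has_vector_derivative A') (at t within S)"
    "(B has_vector_derivative B') (at t within S)" "invertible (P t)"
  defines "Q \<equiv> matrix_inv (P t)"
  shows "((\<lambda>s. metric (P s) (A s) (B s)) has_vector_derivative
     trace (Q ** A' ** Q ** B t) + trace (Q ** A t ** Q ** B')
     - trace (Q ** P' ** Q ** A t ** Q ** B t) - trace (Q ** A t ** Q ** P' ** Q ** B t)) (at t within S)"
proof -
  note inv = has_vector_derivative_matrix_inv[OF assms(1,4), folded Q_def]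
  note * = bounded_linear.has_vector_derivative[OF bounded_linear_trace, OF
    matrix_mult.has_vector_derivative[OF
     matrix_mult.has_vector_derivative[OF matrix_mult.has_vector_derivative[OF inv assms(2)] inv] assms(3)]]
  show ?thesis
    unfolding metric_def
    by (rule has_vector_derivative_eq_rhs[OF *])
       (simp add: Q_def matrix_simps trace_add trace_sub matrix_mul_assoc
        linear_neg[OF bounded_linear.linear[OF bounded_linear_trace]] algebra_simps)
qed


section \<open>The matrix exponential\<close>

text \<open>The norm here is the Euclidean norm of the entries, for which \<open>mat 1\<close> need
  not have norm 1. Hence the constants \<open>K\<close> and \<open>norm (mat 1)\<close> in the
  estimates for the exponential series.\<close>

lemma matrix_mult_norm_bound:
  obtains K where "K > 0" "\<And>(A :: real^'n^'n) (B :: real^'n^'n). norm (A ** B) \<le> norm A * norm B * K"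
proof -
  have "\<exists>K>0. \<forall>(A :: real^'n^'n) (B :: real^'n^'n). norm (A ** B) \<le> norm A * norm B * K"
    by (rule matrix_mult.pos_bounded)
  with that show ?thesis by auto
qed

lemma norm_mat_power_le:
  fixes A :: "real^'n^'n"
  assumes K: "K > 0" "\<And>(A :: real^'n^'n) (B :: real^'n^'n). norm (A ** B) \<le> norm A * norm B * K"
  shows "norm (mat_power A k) \<le> norm (mat 1 :: real^'n^'n) * (K * norm A) ^ k"
proof (induction k)
  case (Suc k)
  have "norm (mat_power A (Suc k)) \<le> norm A * norm (mat_power A k) * K"
    using K by simp
  also have "\<dots> \<le> norm A * (norm (mat 1 :: real^'n^'n) * (K * norm A) ^ k) * K"
    by (intro mult_right_mono mult_left_mono Suc) (use K in auto)
  finally show ?case by (simp add: ac_simps)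
qed simp

lemma mat_power_scaleR: "mat_power (c *\<^sub>R A) k = c ^ k *\<^sub>R mat_power A k"
  by (induction k) (auto simp: matrix_simps ac_simps)

lemma mat_power_commute: "mat_power A k ** A = A ** mat_power A k"
  by (induction k) (auto simp: matrix_mul_assoc[symmetric])

lemma mat_power_transpose: "transpose (mat_power A k) = mat_power (transpose A) k"
  by (induction k) (auto simp: matrix_transpose_mul mat_power_commute)

lemma mat_power_conj:
  fixes A P Q :: "real^'n^'n"
  assumes "Q ** P = mat 1" "P ** Q = mat 1"
  shows "mat_power (P ** A ** Q) k = P ** mat_power A k ** Q"
proof (induction k)
  case (Suc k)
  have "P ** A ** Q ** (P ** mat_power A k ** Q) = P ** A ** (Q ** P) ** mat_power A k ** Q"
    by (simp add: matrix_mul_assoc)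
  with Suc show ?case by (simp add: assms matrix_mul_assoc)
qed (simp add: assms)

lemma mat_exp_term_bound:
  fixes A :: "real^'n^'n"
  assumes K: "K > 0" "\<And>(A :: real^'n^'n) (B :: real^'n^'n). norm (A ** B) \<le> norm A * norm B * K"
  shows "norm ((1 / fact k) *\<^sub>R mat_power A k) \<le>
    norm (mat 1 :: real^'n^'n) * ((K * norm A) ^ k /\<^sub>R fact k)"
  using norm_mat_power_le[OF K, of A k] by (simp add: field_simps)

lemma summable_exp_real: "summable (\<lambda>k. x ^ k /\<^sub>R fact k :: real)"
  by (rule summable_exp_generic)

lemma summable_mat_exp: "summable (\<lambda>k. (1 / fact k) *\<^sub>R mat_power A k)"
proof -
  obtain K where K: "K > 0" "\<And>(A :: real^'a^'a) (B :: real^'a^'a). norm (A ** B) \<le> norm A * norm B * K"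
    using matrix_mult_norm_bound by blast
  show ?thesis
    by (rule summable_comparison_test'[where N=0, OF summable_mult[OF summable_exp_real]])
       (use mat_exp_term_bound[OF K] in blast)
qed

lemma mat_exp_sums: "(\<lambda>k. (1 / fact k) *\<^sub>R mat_power A k) sums mat_exp A"
  unfolding mat_exp_def by (rule summable_sums[OF summable_mat_exp])

lemma mat_exp_zero [simp]: "mat_exp 0 = mat 1"
proof -
  have "(\<lambda>k. (1 / fact k) *\<^sub>R mat_power (0 :: real^'a^'a) k) = (\<lambda>k. if k = 0 then mat 1 else 0)"
    by (auto simp: fun_eq_iff gr0_conv_Suc)
  then show ?thesis
    using mat_exp_sums[of "0 :: real^'a^'a"] sums_single[of 0 "\<lambda>_. mat 1 :: real^'a^'a"]
    by (simp add: sums_unique2)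
qed

lemma mat_exp_transpose: "transpose (mat_exp A) = mat_exp (transpose A)"
proof -
  have "(\<lambda>k. transpose ((1 / fact k) *\<^sub>R mat_power A k)) sums transpose (mat_exp A)"
    by (rule bounded_linear.sums[OF bounded_linear_transpose mat_exp_sums])
  then show ?thesis
    using mat_exp_sums[of "transpose A"]
    by (simp add: transpose_linear_simps mat_power_transpose sums_unique2)
qed

lemma mat_exp_conj:
  fixes A P Q :: "real^'n^'n"
  assumes "Q ** P = mat 1" "P ** Q = mat 1"
  shows "mat_exp (P ** A ** Q) = P ** mat_exp A ** Q"
proof -
  have "(\<lambda>k. P ** ((1 / fact k) *\<^sub>R mat_power A k) ** Q) sums (P ** mat_exp A ** Q)"
    using bounded_linear.sums[OF matrix_mult.bounded_linear_left[of Q]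
        bounded_linear.sums[OF matrix_mult.bounded_linear_right[of P] mat_exp_sums[of A]]] .
  then show ?thesis
    using mat_exp_sums[of "P ** A ** Q"]
    by (simp add: matrix_simps mat_power_conj[OF assms] sums_unique2)
qed

text \<open>Each entry is an everywhere convergent real power series in \<open>t\<close>,
  differentiated termwise. The two forms agree because \<open>A\<close> commutes with its
  powers.\<close>

lemma has_vector_derivative_mat_exp:
  fixes A :: "real^'n^'n"
  shows "((\<lambda>t. mat_exp (t *\<^sub>R A)) has_vector_derivative A ** mat_exp (t *\<^sub>R A)) (at t within S)"
  "((\<lambda>t. mat_exp (t *\<^sub>R A)) has_vector_derivative mat_exp (t *\<^sub>R A) ** A) (at t within S)"
proof -
  \<comment> \<open>The extra factor serves twice: \<open>B = mat 1\<close> gives the series of an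
    entry, \<open>B = A\<close> the differentiated series.\<close>
  have sums: "(\<lambda>k. (B ** ((1 / fact k) *\<^sub>R mat_power A k)) $ i $ j * y ^ k) sums
      (B ** mat_exp (y *\<^sub>R A)) $ i $ j" for B :: "real^'n^'n" and i j y
  proof -
    note bounded_linear.sums[OF matrix_mult.bounded_linear_right[of B] mat_exp_sums[of "y *\<^sub>R A"]]
    from bounded_linear.sums[OF bounded_linear_vec_nth bounded_linear.sums[OF bounded_linear_vec_nth this]]
    show ?thesis
      by (simp add: mat_power_scaleR matrix_simps ac_simps)
  qed
  define c where "c i j k = ((1 / fact k) *\<^sub>R mat_power A k) $ i $ j" for i j k
  have c: "(\<lambda>k. c i j k * y ^ k) sums mat_exp (y *\<^sub>R A) $ i $ j" for i j y
    using sums[of "mat 1"] by (simp add: c_def)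
  have diffs: "diffs (c i j) k = (A ** ((1 / fact k) *\<^sub>R mat_power A k)) $ i $ j" for i j k
    by (simp add: diffs_def c_def matrix_simps del: of_nat_Suc)
  have "((\<lambda>t. mat_exp (t *\<^sub>R A) $ i $ j) has_field_derivative (A ** mat_exp (t *\<^sub>R A)) $ i $ j) (at t)" for i j
    using termdiffs_strong_converges_everywhere[of "c i j" t] c sums[of A i j]
    by (simp add: sums_iff diffs)
  then have "((\<lambda>t. mat_exp (t *\<^sub>R A) $ i $ j) has_vector_derivative (A ** mat_exp (t *\<^sub>R A)) $ i $ j) (at t within S)" for i j
    by (auto simp: has_real_derivative_iff_has_vector_derivative intro: has_vector_derivative_at_within)
  then show *: "((\<lambda>t. mat_exp (t *\<^sub>R A)) has_vector_derivative A ** mat_exp (t *\<^sub>R A)) (at t within S)"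
    unfolding has_vector_derivative_iff_slope
    by (intro vec_tendstoI) simp
  have "A ** mat_exp (t *\<^sub>R A) = mat_exp (t *\<^sub>R A) ** A"
    using bounded_linear.sums[OF matrix_mult.bounded_linear_right[of A] mat_exp_sums[of "t *\<^sub>R A"]]
      bounded_linear.sums[OF matrix_mult.bounded_linear_left[of A] mat_exp_sums[of "t *\<^sub>R A"]]
    by (simp add: matrix_simps mat_power_scaleR mat_power_commute sums_unique2)
  with * show "((\<lambda>t. mat_exp (t *\<^sub>R A)) has_vector_derivative mat_exp (t *\<^sub>R A) ** A) (at t within S)"
    by simp
qed

section \<open>Linear matrix equations and the one-parameter group law\<close>

lemma has_vector_derivative_zero_unique:
  fixes f :: "real \<Rightarrow> 'a::real_normed_vector"
  assumes "convex S" "\<And>t. t \<in> S \<Longrightarrow> (f has_vector_derivative 0) (at t within S)" "s \<in> S" "t \<in> S"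
  shows "f s = f t"
  using has_vector_derivative_zero_constant[OF assms(1,2)] assms(3,4) by metis

lemma mat_exp_minus_aux: "mat_exp (t *\<^sub>R A) ** mat_exp (t *\<^sub>R (- A)) = mat 1"
proof -
  have "((\<lambda>t. mat_exp (t *\<^sub>R A) ** mat_exp (t *\<^sub>R (- A))) has_vector_derivative 0) (at t within UNIV)" for t
    by (rule has_vector_derivative_eq_rhs[OF matrix_mult.has_vector_derivative[OF
          has_vector_derivative_mat_exp(2) has_vector_derivative_mat_exp(1)]])
       (simp add: matrix_simps matrix_mul_assoc)
  from has_vector_derivative_zero_unique[OF convex_UNIV this, of t 0]
  show ?thesis by simp
qed

lemma mat_exp_minus: "mat_exp A ** mat_exp (- A) = mat 1" "mat_exp (- A) ** mat_exp A = mat 1"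
  using mat_exp_minus_aux[of 1 A] mat_exp_minus_aux[of 1 "- A"] by simp_all

lemma matrix_inv_mat_exp: "matrix_inv (mat_exp A) = mat_exp (- A)"
  by (rule matrix_inv_unique(1)[OF mat_exp_minus(1)])

text \<open>Multiplying a solution on the right by exp(-tC) gives a curve with derivative
  zero.\<close>

lemma mat_exp_ode_unique:
  fixes f :: "real \<Rightarrow> real^'n^'n"
  assumes "convex S" "0 \<in> S" "t \<in> S"
    and f: "\<And>t. t \<in> S \<Longrightarrow> (f has_vector_derivative f t ** C) (at t within S)"
  shows "f t = f 0 ** mat_exp (t *\<^sub>R C)"
proof -
  have "((\<lambda>t. f t ** mat_exp (t *\<^sub>R (- C))) has_vector_derivative 0) (at t within S)" if "t \<in> S" for t
    by (rule has_vector_derivative_eq_rhs[OF matrix_mult.has_vector_derivative[OF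
          f[OF that] has_vector_derivative_mat_exp(1)]])
       (simp add: matrix_simps matrix_mul_assoc)
  from has_vector_derivative_zero_unique[OF assms(1) this assms(2,3)]
  have "f 0 = f t ** mat_exp (- (t *\<^sub>R C))" by simp
  then show ?thesis
    by (simp add: matrix_mul_assoc[symmetric] mat_exp_minus)
qed

text \<open>As functions of \<open>t\<close>, both sides solve f' = f A with the same initial
  value.\<close>

lemma mat_exp_add_scaleR: "mat_exp ((s + t) *\<^sub>R A) = mat_exp (s *\<^sub>R A) ** mat_exp (t *\<^sub>R A)"
proof -
  have "((\<lambda>t. mat_exp ((s + t) *\<^sub>R A)) has_vector_derivative mat_exp ((s + t) *\<^sub>R A) ** A) (at t within UNIV)" for t
  proof -
    have "((+) s has_vector_derivative 1) (at t)"
      by (auto intro!: derivative_eq_intros)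
    from vector_diff_chain_within[OF this has_vector_derivative_mat_exp(2)]
    show ?thesis by (simp add: o_def)
  qed
  from mat_exp_ode_unique[OF convex_UNIV _ _ this, of t] show ?thesis by simp
qed

section \<open>Exponentials of symmetric matrices\<close>

lemma mat_exp_Sym: "A \<in> Sym \<Longrightarrow> mat_exp A \<in> Sym"
  by (simp add: Sym_def mat_exp_transpose)

lemma dot_transpose: "(v::real^'n) \<bullet> (A *v w) = (transpose A *v v) \<bullet> w"
  by (simp add: dot_lmul_matrix)

lemma Sym_dot: "A \<in> Sym \<Longrightarrow> v \<bullet> (A *v w) = (A *v v) \<bullet> w"
  by (simp only: dot_transpose Sym_def mem_Collect_eq)

lemma mat_exp_double: "mat_exp A = mat_exp ((1/2) *\<^sub>R A) ** mat_exp ((1/2) *\<^sub>R A)"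
  using mat_exp_add_scaleR[of "1/2" "1/2" A] by simp

lemma mat_exp_psd:
  assumes "A \<in> Sym"
  shows "v \<bullet> (mat_exp A *v v) \<ge> 0"
proof -
  have "v \<bullet> (mat_exp A *v v) = norm (mat_exp ((1/2) *\<^sub>R A) *v v) ^ 2"
    using Sym_dot[OF mat_exp_Sym, of "(1/2) *\<^sub>R A"] subspace_scale[OF subspace_Sym assms]
    by (subst mat_exp_double) (simp add: matrix_vector_mul_assoc[symmetric] power2_norm_eq_inner)
  then show ?thesis by simp
qed

text \<open>The function \<open>\<lambda>t. v \<bullet> (mat_exp (t *\<^sub>R A) *v v)\<close> is convex.\<close>

lemma mat_exp_quadratic_ge:
  assumes "A \<in> Sym"
  shows "v \<bullet> (mat_exp A *v v) \<ge> v \<bullet> v + v \<bullet> (A *v v)"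
proof -
  have bl: "bounded_linear (\<lambda>M::real^'a^'a. v \<bullet> (M *v w))" for w
    by (auto simp: linear_conv_bounded_linear[symmetric] linear_iff algebra_simps
        scaleR_matrix_vector_assoc[symmetric])
  define f where "f t = v \<bullet> (mat_exp (t *\<^sub>R A) *v v)" for t
  define g where "g t = v \<bullet> (mat_exp (t *\<^sub>R A) *v (A *v v))" for t
  define h where "h t = v \<bullet> ((A ** mat_exp (t *\<^sub>R A)) *v (A *v v))" for t
  have f: "(f has_real_derivative g t) (at t)" for t
    using bounded_linear.has_vector_derivative[OF bl has_vector_derivative_mat_exp(2)]
    by (simp add: f_def[abs_def] g_def has_real_derivative_iff_has_vector_derivative matrix_vector_mul_assoc)
  have g: "(g has_real_derivative h t) (at t)" for t
    using bounded_linear.has_vector_derivative[OF bl has_vector_derivative_mat_exp(1)]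
    by (simp add: g_def[abs_def] h_def has_real_derivative_iff_has_vector_derivative)
  have "h t \<ge> 0" for t
    using mat_exp_psd[of "t *\<^sub>R A" "A *v v"] assms subspace_scale[OF subspace_Sym assms]
    by (simp add: h_def matrix_vector_mul_assoc[symmetric] Sym_dot)
  then have mono: "g 0 \<le> g t" if "t \<ge> 0" for t
    using g by (intro DERIV_nonneg_imp_nondecreasing[OF that]) blast
  obtain z where "0 < z" "f 1 - f 0 = g z"
    using MVT2[of 0 1 f g] f by auto
  with mono[of z] show ?thesis
    by (simp add: f_def g_def)
qed

text \<open>Polarization: limits of the quadratic form give limits of the entries.\<close>

lemma Sym_entry:
  assumes "A \<in> Sym"
  shows "A $ i $ j = ((axis i 1 + axis j 1) \<bullet> (A *v (axis i 1 + axis j 1))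
     - (axis i 1 - axis j 1) \<bullet> (A *v (axis i 1 - axis j 1))) / 4"
proof -
  have "axis i 1 \<bullet> (A *v axis j 1) = A $ i $ j" "axis j 1 \<bullet> (A *v axis i 1) = A $ j $ i"
    by (simp_all add: matrix_vector_mult_basis inner_axis' column_def)
  moreover have "A $ i $ j = A $ j $ i"
    using assms by (auto simp: Sym_def transpose_def vec_eq_iff)
  ultimately show ?thesis
    by (simp add: algebra_simps inner_add_left inner_diff_left inner_add_right inner_diff_right)
qed

text \<open>A substitute for continuity of the logarithm at 1. The inequalities 1 + C \<le> exp(C)
  and 1 - C \<le> exp(-C) squeeze the quadratic form of C between those of 1 - exp(-C) and exp(C) -
  1. Symmetry matters: a rotation through a full turn has a nonzero skew logarithm and exponential
  1.\<close>

lemma tendsto_zero_if_mat_exp_tendsto_one: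
  fixes C :: "'a \<Rightarrow> real^'n^'n"
  assumes C: "\<And>s. C s \<in> Sym" and lim: "((\<lambda>s. mat_exp (C s)) \<longlongrightarrow> mat 1) F"
  shows "(C \<longlongrightarrow> 0) F"
proof -
  have inv1: "invertible (mat 1 :: real^'n^'n)" "matrix_inv (mat 1 :: real^'n^'n) = mat 1"
    using matrix_inv_unique[of "mat 1 :: real^'n^'n" "mat 1"] by simp_all
  have lim': "((\<lambda>s. mat_exp (- C s)) \<longlongrightarrow> mat 1) F"
    using tendsto_matrix_inv[OF lim inv1(1)] by (simp add: matrix_inv_mat_exp inv1)
  have bl: "bounded_linear (\<lambda>M::real^'n^'n. v \<bullet> (M *v v))" for v
    by (auto simp: linear_conv_bounded_linear[symmetric] linear_iff algebra_simps
        scaleR_matrix_vector_assoc[symmetric])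
  have q: "((\<lambda>s. v \<bullet> (C s *v v)) \<longlongrightarrow> 0) F" for v
  proof (rule tendsto_sandwich)
    show "\<forall>\<^sub>F s in F. v \<bullet> v - v \<bullet> (mat_exp (- C s) *v v) \<le> v \<bullet> (C s *v v)"
      using mat_exp_quadratic_ge[OF subspace_neg[OF subspace_Sym C], of v]
      by (intro always_eventually allI) (simp add: linear_simps[OF bl] algebra_simps)
    show "\<forall>\<^sub>F s in F. v \<bullet> (C s *v v) \<le> v \<bullet> (mat_exp (C s) *v v) - v \<bullet> v"
      using mat_exp_quadratic_ge[OF C, of v]
      by (intro always_eventually allI) (simp add: algebra_simps)
    show "((\<lambda>s. v \<bullet> v - v \<bullet> (mat_exp (- C s) *v v)) \<longlongrightarrow> 0) F"
      using tendsto_diff[OF tendsto_const[of "v \<bullet> v"] bounded_linear.tendsto[OF bl[of v] lim']] by simp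
    show "((\<lambda>s. v \<bullet> (mat_exp (C s) *v v) - v \<bullet> v) \<longlongrightarrow> 0) F"
      using tendsto_diff[OF bounded_linear.tendsto[OF bl[of v] lim] tendsto_const[of "v \<bullet> v"]] by simp
  qed
  show ?thesis
  proof (intro vec_tendstoI)
    fix i j
    have "((\<lambda>s. C s $ i $ j) \<longlongrightarrow> (0 - 0) / 4) F"
      unfolding Sym_entry[OF C, of _ i j] by (intro tendsto_intros q) auto
    then show "((\<lambda>s. C s $ i $ j) \<longlongrightarrow> (0 :: real^'n^'n) $ i $ j) F"
      by simp
  qed
qed

text \<open>The factor \<open>norm A ^ m\<close> splits off the tail; what remains is dominated by
  the series of exp K, because the factorials only grow and \<open>norm A\<close> is at most
  1.\<close>

lemma mat_exp_remainder:
  fixes m :: nat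
  obtains c where "c > 0" "\<And>A :: real^'n^'n. norm A \<le> 1 \<Longrightarrow>
     norm (mat_exp A - (\<Sum>k<m. (1 / fact k) *\<^sub>R mat_power A k)) \<le> c * norm A ^ m"
proof -
  obtain K where K: "K > 0" "\<And>(A :: real^'n^'n) (B :: real^'n^'n). norm (A ** B) \<le> norm A * norm B * K"
    using matrix_mult_norm_bound by blast
  let ?n = "norm (mat 1 :: real^'n^'n)"
  have "norm (mat_exp A - (\<Sum>k<m. (1 / fact k) *\<^sub>R mat_power A k)) \<le> (?n * K ^ m * exp K + 1) * norm A ^ m"
    if "norm A \<le> 1" for A :: "real^'n^'n"
  proof -
    have "mat_exp A - (\<Sum>k<m. (1 / fact k) *\<^sub>R mat_power A k) =
        (\<Sum>k. (1 / fact (k + m)) *\<^sub>R mat_power A (k + m))"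
      using suminf_minus_initial_segment[OF summable_mat_exp[of A], of m] by (simp add: mat_exp_def)
    also have "norm \<dots> \<le> (\<Sum>k. ?n * (K * norm A) ^ m * (K ^ k /\<^sub>R fact k))"
    proof (rule norm_suminf_le)
      show "summable (\<lambda>k. ?n * (K * norm A) ^ m * (K ^ k /\<^sub>R fact k))"
        by (rule summable_mult[OF summable_exp_real])
      fix k
      have "norm ((1 / fact (k + m)) *\<^sub>R mat_power A (k + m)) \<le>
          ?n * ((K * norm A) ^ (k + m) /\<^sub>R fact (k + m))"
        by (rule mat_exp_term_bound[OF K])
      also have "\<dots> \<le> ?n * ((K * norm A) ^ (k + m) /\<^sub>R fact k)"
        using K by (intro mult_left_mono scaleR_right_mono)
          (auto intro!: le_imp_inverse_le fact_mono)
      also have "\<dots> = ?n * (K * norm A) ^ m * (K ^ k /\<^sub>R fact k) * norm A ^ k"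
        by (simp add: power_add power_mult_distrib)
      also have "\<dots> \<le> ?n * (K * norm A) ^ m * (K ^ k /\<^sub>R fact k)"
        using K that by (intro mult_left_le power_le_one) auto
      finally show "norm ((1 / fact (k + m)) *\<^sub>R mat_power A (k + m)) \<le>
          ?n * (K * norm A) ^ m * (K ^ k /\<^sub>R fact k)" .
    qed
    also have "\<dots> = ?n * (K * norm A) ^ m * exp K"
      unfolding exp_def by (rule suminf_mult[OF summable_exp_real])
    also have "\<dots> = (?n * K ^ m * exp K) * norm A ^ m"
      by (simp add: power_mult_distrib)
    also have "\<dots> \<le> (?n * K ^ m * exp K + 1) * norm A ^ m"
      by (intro mult_right_mono) auto
    finally show ?thesis .
  qed
  moreover have "?n * K ^ m * exp K + 1 > 0"
    using K by (intro add_nonneg_pos) auto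
  ultimately show ?thesis using that by blast
qed


section \<open>Second-order expansions\<close>

text \<open>Peano form of f(s) = a0 + s a1 + s^2 a2 + o(s^2) for s decreasing to 0. It asks for no
  differentiability near 0, so it applies to logarithms \<open>Z s\<close> that are picked
  separately for each \<open>s\<close>.\<close>

definition expands2 :: "(real \<Rightarrow> real^'n^'n) \<Rightarrow> real^'n^'n \<Rightarrow> real^'n^'n \<Rightarrow> real^'n^'n \<Rightarrow> bool" where
  "expands2 f a0 a1 a2 \<longleftrightarrow>
    ((\<lambda>s. (f s - a0 - s *\<^sub>R a1) /\<^sub>R s\<^sup>2) \<longlongrightarrow> a2) (at_right 0)"

lemma expands2E:
  assumes "expands2 f a0 a1 a2"
  obtains f2 where "\<And>s. s \<noteq> 0 \<Longrightarrow> f s = a0 + s *\<^sub>R a1 + s\<^sup>2 *\<^sub>R f2 s" "(f2 \<longlongrightarrow> a2) (at_right 0)"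
  using assms by (intro that[of "\<lambda>s. (f s - a0 - s *\<^sub>R a1) /\<^sub>R s\<^sup>2"]) (auto simp: expands2_def)

lemma expands2I:
  assumes "\<And>s. s > 0 \<Longrightarrow> f s = a0 + s *\<^sub>R a1 + s\<^sup>2 *\<^sub>R f2 s" "(f2 \<longlongrightarrow> a2) (at_right 0)"
  shows "expands2 f a0 a1 a2"
  unfolding expands2_def
  by (rule Lim_transform_eventually[OF assms(2)])
     (auto simp: eventually_at_right_field assms(1) intro!: exI[of _ 1])

lemma expands2_first_order:
  assumes "expands2 f 0 a1 a2"
  shows "((\<lambda>s. f s /\<^sub>R s) \<longlongrightarrow> a1) (at_right 0)" "(f \<longlongrightarrow> 0) (at_right 0)"
proof -
  obtain f2 where f2: "\<And>s. s \<noteq> 0 \<Longrightarrow> f s = 0 + s *\<^sub>R a1 + s\<^sup>2 *\<^sub>R f2 s" "(f2 \<longlongrightarrow> a2) (at_right 0)"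
    using expands2E[OF assms] by blast
  have "((\<lambda>s. a1 + s *\<^sub>R f2 s) \<longlongrightarrow> a1 + 0 *\<^sub>R a2) (at_right 0)"
    by (intro tendsto_intros f2(2))
  then have *: "((\<lambda>s. a1 + s *\<^sub>R f2 s) \<longlongrightarrow> a1) (at_right 0)" by simp
  then show "((\<lambda>s. f s /\<^sub>R s) \<longlongrightarrow> a1) (at_right 0)"
    by (rule Lim_transform_eventually)
      (auto simp: eventually_at_right_field f2(1) scaleR_add_right power2_eq_square intro!: exI[of _ 1])
  have "((\<lambda>s. s *\<^sub>R (a1 + s *\<^sub>R f2 s)) \<longlongrightarrow> 0 *\<^sub>R a1) (at_right 0)"
    by (intro tendsto_scaleR tendsto_ident_at *)
  then show "(f \<longlongrightarrow> 0) (at_right 0)"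
    unfolding scaleR_zero_left by (rule Lim_transform_eventually)
      (auto simp: eventually_at_right_field f2(1) scaleR_add_right power2_eq_square intro!: exI[of _ 1])
qed

lemma expands2_mult:
  assumes "expands2 f a0 a1 a2" "expands2 g b0 b1 b2"
  shows "expands2 (\<lambda>s. f s ** g s) (a0 ** b0) (a0 ** b1 + a1 ** b0) (a0 ** b2 + a1 ** b1 + a2 ** b0)"
proof -
  obtain f2 where f2: "\<And>s. s \<noteq> 0 \<Longrightarrow> f s = a0 + s *\<^sub>R a1 + s\<^sup>2 *\<^sub>R f2 s" "(f2 \<longlongrightarrow> a2) (at_right 0)"
    using expands2E[OF assms(1)] by blast
  obtain g2 where g2: "\<And>s. s \<noteq> 0 \<Longrightarrow> g s = b0 + s *\<^sub>R b1 + s\<^sup>2 *\<^sub>R g2 s" "(g2 \<longlongrightarrow> b2) (at_right 0)"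
    using expands2E[OF assms(2)] by blast
  let ?h = "\<lambda>s. a0 ** g2 s + a1 ** b1 + f2 s ** b0 + s *\<^sub>R (a1 ** g2 s + f2 s ** b1) + s\<^sup>2 *\<^sub>R (f2 s ** g2 s)"
  have "(?h \<longlongrightarrow> a0 ** b2 + a1 ** b1 + a2 ** b0 + 0 *\<^sub>R (a1 ** b2 + a2 ** b1) + 0\<^sup>2 *\<^sub>R (a2 ** b2)) (at_right 0)"
    by (intro tendsto_intros matrix_mult.tendsto f2(2) g2(2))
  then have lim: "(?h \<longlongrightarrow> a0 ** b2 + a1 ** b1 + a2 ** b0) (at_right 0)"
    by simp
  show ?thesis
    by (rule expands2I[OF _ lim])
       (simp add: f2(1) g2(1) matrix_simps power2_eq_square algebra_simps)
qed

lemma expands2_const: "expands2 (\<lambda>s. a) a 0 0"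
  by (simp add: expands2_def)

lemma expands2_scaleR:
  assumes "expands2 f a0 a1 a2"
  shows "expands2 (\<lambda>s. c *\<^sub>R f s) (c *\<^sub>R a0) (c *\<^sub>R a1) (c *\<^sub>R a2)"
proof -
  obtain f2 where f2: "\<And>s. s \<noteq> 0 \<Longrightarrow> f s = a0 + s *\<^sub>R a1 + s\<^sup>2 *\<^sub>R f2 s" "(f2 \<longlongrightarrow> a2) (at_right 0)"
    using expands2E[OF assms(1)] by blast
  show ?thesis
    by (rule expands2I[OF _ tendsto_scaleR[OF tendsto_const f2(2)]]) (simp add: f2(1) algebra_simps)
qed

lemma expands2_transpose:
  assumes "expands2 f a0 a1 a2"
  shows "expands2 (\<lambda>s. transpose (f s)) (transpose a0) (transpose a1) (transpose a2)"
proof -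
  obtain f2 where f2: "\<And>s. s \<noteq> 0 \<Longrightarrow> f s = a0 + s *\<^sub>R a1 + s\<^sup>2 *\<^sub>R f2 s" "(f2 \<longlongrightarrow> a2) (at_right 0)"
    using expands2E[OF assms(1)] by blast
  show ?thesis
    by (rule expands2I[OF _ bounded_linear.tendsto[OF bounded_linear_transpose f2(2)]])
       (simp add: f2(1) transpose_linear_simps)
qed

text \<open>The Taylor remainder after degree m is of order m + 1 in Z; as Z = O(s), m of these
  factors absorb the division by s^m and the last one tends to 0.\<close>

lemma mat_exp_remainder_tendsto:
  fixes Z :: "real \<Rightarrow> real^'n^'n"
  assumes "(Z \<longlongrightarrow> 0) F" and bnd: "\<forall>\<^sub>F s in F. norm (Z s) \<le> b * \<bar>s\<bar>"
  shows "((\<lambda>s. (mat_exp (Z s) - mat 1 - Z s) /\<^sub>R s) \<longlongrightarrow> 0) F"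
    and "((\<lambda>s. (mat_exp (Z s) - mat 1 - Z s - (1/2) *\<^sub>R (Z s ** Z s)) /\<^sub>R s\<^sup>2) \<longlongrightarrow> 0) F"
proof -
  have main: "((\<lambda>s. (mat_exp (Z s) - (\<Sum>k<Suc m. (1 / fact k) *\<^sub>R mat_power (Z s) k)) /\<^sub>R s ^ m) \<longlongrightarrow> 0) F" for m
  proof -
    obtain c where c: "c > 0" "\<And>A :: real^'n^'n. norm A \<le> 1 \<Longrightarrow>
     norm (mat_exp A - (\<Sum>k<Suc m. (1 / fact k) *\<^sub>R mat_power A k)) \<le> c * norm A ^ Suc m"
      using mat_exp_remainder by blast
    have lim: "((\<lambda>s. c * norm (Z s) * b ^ m) \<longlongrightarrow> 0) F"
      using assms(1) by (intro tendsto_mult_left_zero tendsto_mult_right_zero tendsto_norm_zero)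
    have "\<forall>\<^sub>F s in F. norm (Z s) < 1"
      using order_tendstoD(2)[OF tendsto_norm_zero[OF assms(1)]] by simp
    then have "\<forall>\<^sub>F s in F. norm ((mat_exp (Z s) - (\<Sum>k<Suc m. (1 / fact k) *\<^sub>R mat_power (Z s) k)) /\<^sub>R s ^ m)
        \<le> c * norm (Z s) * b ^ m"
      using bnd
    proof eventually_elim
      case (elim s)
      show ?case
      proof (cases "b * \<bar>s\<bar> = 0")
        \<comment> \<open>This covers s = 0, where the quotient may be a division by zero, and b =
          0. The bound forces \<open>Z s = 0\<close>, so the remainder itself vanishes.\<close>
        case True
        then have "Z s = 0" using elim by auto
        then have "norm (mat_exp (Z s) - (\<Sum>k<Suc m. (1 / fact k) *\<^sub>R mat_power (Z s) k)) \<le> 0"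
          using c(2)[of "Z s"] by simp
        with \<open>Z s = 0\<close> show ?thesis by simp
      next
        case False
        have "norm (mat_exp (Z s) - (\<Sum>k<Suc m. (1 / fact k) *\<^sub>R mat_power (Z s) k)) \<le> c * norm (Z s) ^ Suc m"
          using elim c(2) by simp
        also have "\<dots> \<le> c * (norm (Z s) * (b * \<bar>s\<bar>) ^ m)"
          using elim c(1) by (simp add: mult_left_mono power_mono)
        finally show ?thesis
          using False by (simp del: sum.lessThan_Suc
              add: inverse_eq_divide pos_divide_le_eq power_mult_distrib power_abs ac_simps)
      qed
    qed
    then show ?thesis by (rule Lim_null_comparison[OF _ lim])
  qed
  show "((\<lambda>s. (mat_exp (Z s) - mat 1 - Z s) /\<^sub>R s) \<longlongrightarrow> 0) F"
    using main[of 1] by (simp add: numeral_eq_Suc algebra_simps)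
  show "((\<lambda>s. (mat_exp (Z s) - mat 1 - Z s - (1/2) *\<^sub>R (Z s ** Z s)) /\<^sub>R s\<^sup>2) \<longlongrightarrow> 0) F"
    using main[of 2] by (simp add: numeral_eq_Suc algebra_simps)
qed

lemma eventually_norm_le_abs:
  fixes Z :: "real \<Rightarrow> 'a::real_normed_vector"
  assumes "((\<lambda>s. Z s /\<^sub>R s) \<longlongrightarrow> z) (at_right 0)"
  shows "\<forall>\<^sub>F s in at_right 0. norm (Z s) \<le> (norm z + 1) * \<bar>s\<bar>"
proof -
  have "\<forall>\<^sub>F s in at_right 0. norm (Z s /\<^sub>R s) < norm z + 1"
    using order_tendstoD(2)[OF tendsto_norm[OF assms]] by simp
  moreover have "\<forall>\<^sub>F s in at_right (0::real). s > 0"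
    by (simp add: eventually_at_right_less)
  ultimately show ?thesis
    by eventually_elim (simp add: field_simps)
qed

lemma expands2_mat_exp:
  assumes "expands2 Z 0 z1 z2"
  shows "expands2 (\<lambda>s. mat_exp (Z s)) (mat 1) z1 (z2 + (1/2) *\<^sub>R (z1 ** z1))"
proof -
  note Z = expands2_first_order[OF assms]
  let ?Zs = "\<lambda>s. Z s /\<^sub>R s"
  have "((\<lambda>s. (Z s - 0 - s *\<^sub>R z1) /\<^sub>R s\<^sup>2 + (1/2) *\<^sub>R (?Zs s ** ?Zs s)
      + (mat_exp (Z s) - mat 1 - Z s - (1/2) *\<^sub>R (Z s ** Z s)) /\<^sub>R s\<^sup>2) \<longlongrightarrow>
      z2 + (1/2) *\<^sub>R (z1 ** z1) + 0) (at_right 0)"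
    by (intro tendsto_add tendsto_scaleR tendsto_const matrix_mult.tendsto Z(1)
        assms[unfolded expands2_def] mat_exp_remainder_tendsto(2)[OF Z(2) eventually_norm_le_abs[OF Z(1)]])
  then show ?thesis
    unfolding expands2_def
    by (rule tendsto_eq_rhs[OF tendsto_cong[THEN iffD1, rotated]])
       (auto simp: matrix_simps power2_eq_square scaleR_diff_right scaleR_add_right field_simps intro!: always_eventually)
qed

text \<open>First a crude estimate Z = O(s), which makes the remainder of the exponential o(s); then
  Z and exp(Z) - 1 have the same slope.\<close>

lemma mat_exp_first_order_inverse:
  fixes Z :: "real \<Rightarrow> real^'n^'n"
  assumes Z: "(Z \<longlongrightarrow> 0) (at_right 0)"
    and e: "((\<lambda>s. (mat_exp (Z s) - mat 1) /\<^sub>R s) \<longlongrightarrow> e) (at_right 0)"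
  shows "((\<lambda>s. Z s /\<^sub>R s) \<longlongrightarrow> e) (at_right 0)"
proof -
  obtain c where c: "c > 0" "\<And>A :: real^'n^'n. norm A \<le> 1 \<Longrightarrow>
     norm (mat_exp A - (\<Sum>k<2. (1 / fact k) *\<^sub>R mat_power A k)) \<le> c * norm A ^ 2"
    using mat_exp_remainder by blast
  have c: "c > 0" "\<And>A :: real^'n^'n. norm A \<le> 1 \<Longrightarrow> norm (mat_exp A - mat 1 - A) \<le> c * norm A ^ 2"
    using c by (simp_all add: numeral_2_eq_2 algebra_simps)
  \<comment> \<open>The bound 1 makes the Taylor estimate applicable, and 1 / (2c) lets the
    quadratic remainder be absorbed by half of \<open>norm (Z s)\<close>.\<close>
  have "\<forall>\<^sub>F s in at_right 0. norm (Z s) < min 1 (1 / (2 * c))"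
    by (rule order_tendstoD(2)[OF tendsto_norm_zero[OF Z]]) (use c(1) in simp)
  moreover have "\<forall>\<^sub>F s in at_right 0. norm (mat_exp (Z s) - mat 1) \<le> (norm e + 1) * \<bar>s\<bar>"
    by (rule eventually_norm_le_abs[OF e])
  ultimately have bnd: "\<forall>\<^sub>F s in at_right 0. norm (Z s) \<le> (2 * (norm e + 1)) * \<bar>s\<bar>"
  proof eventually_elim
    case (elim s)
    have "c * norm (Z s) \<le> 1/2"
      using elim(1) c(1) by (simp add: field_simps)
    then have "c * norm (Z s) ^ 2 \<le> norm (Z s) / 2"
      using mult_right_mono[of "c * norm (Z s)" "1/2" "norm (Z s)"] by (simp add: power2_eq_square)
    moreover have "norm (Z s) \<le> norm (mat_exp (Z s) - mat 1) + norm (mat_exp (Z s) - mat 1 - Z s)"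
      by (metis norm_triangle_sub add_diff_cancel_left' diff_diff_eq2 norm_minus_commute norm_triangle_ineq4)
    ultimately have "norm (Z s) \<le> 2 * norm (mat_exp (Z s) - mat 1)"
      using c(2)[of "Z s"] elim(1) by simp
    then show ?case using elim(2) by (simp add: algebra_simps)
  qed
  have "((\<lambda>s. (mat_exp (Z s) - mat 1) /\<^sub>R s - (mat_exp (Z s) - mat 1 - Z s) /\<^sub>R s) \<longlongrightarrow> e - 0) (at_right 0)"
    by (intro tendsto_diff e mat_exp_remainder_tendsto(1)[OF Z bnd])
  then show ?thesis
    by (simp add: scaleR_diff_right)
qed

text \<open>The coefficients are those of log(1 + e) = e - e^2/2 + ...; the hypothesis that Z tends
  to 0 selects the right branch.\<close>

lemma expands2_mat_exp_inverse:
  fixes Z :: "real \<Rightarrow> real^'n^'n"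
  assumes Z: "(Z \<longlongrightarrow> 0) (at_right 0)" and e: "expands2 (\<lambda>s. mat_exp (Z s)) (mat 1) e1 e2"
  shows "expands2 Z 0 e1 (e2 - (1/2) *\<^sub>R (e1 ** e1))"
proof -
  have "expands2 (\<lambda>s. mat_exp (Z s) - mat 1) 0 e1 e2"
    using e by (simp add: expands2_def)
  note first = mat_exp_first_order_inverse[OF Z expands2_first_order(1)[OF this]]
  let ?Zs = "\<lambda>s. Z s /\<^sub>R s"
  have "((\<lambda>s. (mat_exp (Z s) - mat 1 - s *\<^sub>R e1) /\<^sub>R s\<^sup>2 - (1/2) *\<^sub>R (?Zs s ** ?Zs s)
      - (mat_exp (Z s) - mat 1 - Z s - (1/2) *\<^sub>R (Z s ** Z s)) /\<^sub>R s\<^sup>2) \<longlongrightarrow>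
      e2 - (1/2) *\<^sub>R (e1 ** e1) - 0) (at_right 0)"
    by (intro tendsto_diff tendsto_scaleR tendsto_const matrix_mult.tendsto first
        e[unfolded expands2_def] mat_exp_remainder_tendsto(2)[OF Z eventually_norm_le_abs[OF first]])
  then show ?thesis
    unfolding expands2_def
    by (rule tendsto_eq_rhs[OF tendsto_cong[THEN iffD1, rotated]])
       (auto simp: matrix_simps power2_eq_square scaleR_diff_right scaleR_add_right field_simps intro!: always_eventually)
qed

lemma expands2_exp_ray: "expands2 (\<lambda>s. mat_exp (s *\<^sub>R X)) (mat 1) X ((1/2) *\<^sub>R (X ** X))"
proof -
  have "expands2 (\<lambda>s. s *\<^sub>R X) 0 X 0"
    by (simp add: expands2_def)
  from expands2_mat_exp[OF this] show ?thesis by simp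
qed


section \<open>Positive definite matrices\<close>

lemma SPD_Sym: "A \<in> SPD \<Longrightarrow> A \<in> Sym"
  by (simp add: SPD_def)

lemma SPD_invertible:
  fixes A :: "real^'n^'n"
  assumes "A \<in> SPD"
  shows "invertible A"
proof -
  have "A *v v = 0 \<Longrightarrow> v = 0" for v
    using assms by (force simp: SPD_def)
  then show ?thesis
    by (metis invertible_left_inverse matrix_left_invertible_ker)
qed

lemma matrix_inv_Sym:
  fixes A :: "real^'n^'n"
  assumes "A \<in> Sym" "invertible A"
  shows "matrix_inv A \<in> Sym"
proof -
  let ?B = "matrix_inv A"
  have "transpose ?B = transpose ?B ** (A ** ?B)"
    by (simp add: matrix_inv_right assms)
  also have "\<dots> = transpose (A ** ?B) ** ?B"
    using assms(1) by (simp add: matrix_transpose_mul Sym_def matrix_mul_assoc)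
  finally show ?thesis by (simp add: Sym_def matrix_inv_right assms)
qed

text \<open>\<open>m\<close> is the minimum of the quadratic form on the compact unit
  sphere.\<close>

lemma SPD_coercive:
  fixes A :: "real^'n^'n"
  assumes "A \<in> SPD"
  obtains m where "m > 0" "\<And>v. m * (v \<bullet> v) \<le> v \<bullet> (A *v v)"
proof -
  let ?S = "sphere (0::real^'n) 1"
  have "continuous_on ?S (\<lambda>v. v \<bullet> (A *v v))"
    by (intro continuous_intros)
  moreover have "?S \<noteq> {}" by simp
  ultimately obtain u where u: "u \<in> ?S" "\<And>v. v \<in> ?S \<Longrightarrow> u \<bullet> (A *v u) \<le> v \<bullet> (A *v v)"
    using continuous_attains_inf[OF compact_sphere] by blast
  have pos: "u \<bullet> (A *v u) > 0"
  proof -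
    have "u \<noteq> 0" using u(1) by auto
    with assms show ?thesis by (simp add: SPD_def)
  qed
  have "u \<bullet> (A *v u) * (v \<bullet> v) \<le> v \<bullet> (A *v v)" for v
  proof (cases "v = 0")
    case False
    then have "u \<bullet> (A *v u) \<le> sgn v \<bullet> (A *v sgn v)"
      by (intro u(2)) (simp add: norm_sgn)
    also have "\<dots> = (v \<bullet> (A *v v)) / (norm v)\<^sup>2"
      by (simp add: sgn_div_norm matrix_vector_mult_scaleR power2_eq_square divide_inverse)
    finally show ?thesis
      using False by (simp add: field_simps power2_norm_eq_inner)
  qed simp
  with pos show ?thesis using that by blast
qed

lemma openin_SPD: "openin (top_of_set Sym) (SPD :: (real^'n^'n) set)"
proof -
  obtain K where K: "K > 0" "\<And>(A :: real^'n^'n) v. norm (A *v v) \<le> norm A * norm v * K"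
    using bounded_bilinear.pos_bounded[of "(*v) :: real^'n^'n \<Rightarrow> _"]
    by (auto simp: bilinear_conv_bounded_bilinear[symmetric] bilinear_def linear_iff algebra_simps
        scaleR_matrix_vector_assoc[symmetric])
  have "\<exists>e>0. \<forall>B\<in>Sym. dist B A < e \<longrightarrow> B \<in> SPD" if A: "A \<in> SPD" for A :: "real^'n^'n"
  proof -
    obtain m where m: "m > 0" "\<And>v. m * (v \<bullet> v) \<le> v \<bullet> (A *v v)"
      using SPD_coercive[OF A] by blast
    \<comment> \<open>Radius m / K: a perturbation of smaller norm changes the quadratic form at v
      by less than m |v|^2.\<close>
    have "B \<in> SPD" if B: "B \<in> Sym" "dist B A < m / K" for B
      unfolding SPD_def
    proof (intro CollectI conjI B allI impI)
      fix v :: "real^'n" assume "v \<noteq> 0"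
      have "\<bar>v \<bullet> ((B - A) *v v)\<bar> \<le> norm v * (norm (B - A) * norm v * K)"
        by (rule order_trans[OF Cauchy_Schwarz_ineq2 mult_left_mono[OF K(2)]]) simp
      also have "\<dots> < norm v * (m / K * norm v * K)"
        using B \<open>v \<noteq> 0\<close> K by (intro mult_strict_left_mono mult_strict_right_mono) (auto simp: dist_norm)
      also have "\<dots> = m * (v \<bullet> v)"
        using K by (simp add: dot_square_norm power2_eq_square)
      also have "\<dots> \<le> v \<bullet> (A *v v)" by (rule m)
      finally show "v \<bullet> (B *v v) > 0"
        by (simp add: algebra_simps inner_diff_right)
    qed
    then show ?thesis using m K by (intro exI[of _ "m / K"]) auto
  qed
  moreover have "SPD \<subseteq> (Sym :: (real^'n^'n) set)"
    by (auto simp: SPD_def)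
  ultimately show ?thesis
    unfolding openin_euclidean_subtopology_iff by blast
qed

text \<open>For symmetric matrices the quadratic form controls the operator norm: polarize, then
  bound each square by the hypothesis.\<close>

lemma onorm_Sym_le:
  fixes B :: "real^'n^'n"
  assumes B: "B \<in> Sym" and r: "\<And>v. \<bar>v \<bullet> (B *v v)\<bar> \<le> r * (v \<bullet> v)"
  shows "norm (B *v v) \<le> r * norm v"
proof -
  have "4 * (u \<bullet> (B *v v)) \<le> 2 * r * (u \<bullet> u + v \<bullet> v)" for u v
  proof -
    have "4 * (u \<bullet> (B *v v)) = (u + v) \<bullet> (B *v (u + v)) - (u - v) \<bullet> (B *v (u - v))"
      using Sym_dot[OF B, of u v] by (simp add: algebra_simps inner_add_left inner_diff_left inner_add_right inner_diff_right inner_commute)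
    also have "\<dots> \<le> r * ((u + v) \<bullet> (u + v)) + r * ((u - v) \<bullet> (u - v))"
      using r[of "u + v"] r[of "u - v"] by linarith
    also have "\<dots> = 2 * r * (u \<bullet> u + v \<bullet> v)"
      by (simp add: algebra_simps inner_add_left inner_diff_left inner_add_right inner_diff_right inner_commute)
    finally show ?thesis .
  qed
  note * = this
  show ?thesis
  proof (cases "v = 0 \<or> B *v v = 0")
    case True
    have "0 \<le> r * norm v" if "v \<noteq> 0"
    proof -
      have "0 \<le> r * (norm v * norm v)"
        using r[of v] by (simp add: dot_square_norm power2_eq_square)
      with that have "0 \<le> r"
        by (metis zero_less_norm_iff mult_pos_pos zero_le_mult_iff not_less)
      then show ?thesis by simp
    qed
    with True show ?thesis by (cases "v = 0") auto
  next
    case False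
    define w where "w = B *v v"
    have w: "norm w > 0" "norm v > 0" using False by (auto simp: w_def)
    \<comment> \<open>The test vector is B v rescaled to the length of v, which balances the two
      squares on the right.\<close>
    have "4 * ((norm v / norm w) *\<^sub>R w \<bullet> w) \<le>
        2 * r * ((norm v / norm w) *\<^sub>R w \<bullet> (norm v / norm w) *\<^sub>R w + v \<bullet> v)"
      using *[of "(norm v / norm w) *\<^sub>R w" v] by (simp add: w_def)
    then have "4 * (norm v * norm w) \<le> 4 * (norm v * (r * norm v))"
      using w by (simp add: dot_square_norm power2_eq_square field_simps)
    then show ?thesis using w by (simp add: w_def)
  qed
qed

lemma norm_transpose: "norm (transpose A) = norm (A :: real^'n^'n)"
proof -
  have "transpose A \<bullet> transpose A = A \<bullet> A"
    unfolding inner_vec_def transpose_def by simp (rule sum.swap)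
  then show ?thesis by (simp add: norm_eq_sqrt_inner)
qed

text \<open>The rows of \<open>D ** Y\<close> are the images under Y of the rows of D, so an
  operator bound on Y becomes a bound in the Euclidean matrix norm. That is the distance in which
  the square root iteration has to contract.\<close>

lemma norm_mult_Sym_le:
  fixes D Y :: "real^'n^'n"
  assumes Y: "Y \<in> Sym" "\<And>v. norm (Y *v v) \<le> r * norm v" and r: "0 \<le> r"
  shows "norm (D ** Y) \<le> r * norm D"
proof -
  have "Y $ k $ i = Y $ i $ k" for i k
    using Y(1) by (auto simp: Sym_def transpose_def vec_eq_iff)
  then have "(D ** Y) $ i = Y *v D $ i" for i
    by (simp add: vec_eq_iff matrix_matrix_mult_def matrix_vector_mult_def mult.commute)
  then have "norm ((D ** Y) $ i) \<le> r * norm (D $ i)" for i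
    using Y by (simp add: Sym_def)
  then have "L2_set (\<lambda>i. norm ((D ** Y) $ i)) UNIV \<le> L2_set (\<lambda>i. r * norm (D $ i)) UNIV"
    by (intro L2_set_mono) auto
  then show ?thesis
    using r by (simp add: norm_vec_def L2_set_right_distrib)
qed

text \<open>
  After scaling, \<open>A = 1 - B\<close> with \<open>\<parallel>B\<parallel> < 1\<close>, and \<open>1 - Y\<close> is a square root of \<open>A\<close> when \<open>Y\<close> is a
  fixed point of the contraction \<open>Y \<mapsto> (B + Y\<^sup>2) / 2\<close>.
\<close>

lemma SPD_sqrt:
  fixes A :: "real^'n^'n"
  assumes A: "A \<in> SPD"
  obtains x where "x \<in> SPD" "x ** x = A"
proof -
  obtain m where m: "m > 0" "\<And>v. m * (v \<bullet> v) \<le> v \<bullet> (A *v v)"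
    using SPD_coercive[OF A] by blast
  obtain k where k: "k > 0" "\<And>v. norm (A *v v) \<le> norm v * k"
    using bounded_linear.pos_bounded[OF matrix_vector_mul_bounded_linear] by blast
  \<comment> \<open>The choice gives A \<le> c together with m < c, so that r = 1 - m / c lies
    strictly between 0 and 1.\<close>
  define c where "c = max k (m + 1)"
  have c: "c > 0" "m < c" using m by (auto simp: c_def)
  have up: "v \<bullet> (A *v v) \<le> c * (v \<bullet> v)" for v
  proof -
    have "v \<bullet> (A *v v) \<le> norm v * (norm v * k)"
      by (rule order_trans[OF norm_cauchy_schwarz mult_left_mono[OF k(2)]]) simp
    also have "\<dots> = k * (v \<bullet> v)" by (simp add: dot_square_norm power2_eq_square)
    also have "\<dots> \<le> c * (v \<bullet> v)" by (intro mult_right_mono) (auto simp: c_def)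
    finally show ?thesis .
  qed
  define B where "B = mat 1 - (1 / c) *\<^sub>R A"
  define r where "r = 1 - m / c"
  have r: "0 < r" "r < 1" using m c by (auto simp: r_def)
  have Bsym: "B \<in> Sym"
    using SPD_Sym[OF A] by (simp add: B_def Sym_def transpose_linear_simps)
  have Bv: "v \<bullet> (B *v v) = v \<bullet> v - (v \<bullet> (A *v v)) / c" for v
    by (simp add: B_def algebra_simps scaleR_matrix_vector_assoc[symmetric] inner_diff_right)
  have "\<bar>v \<bullet> (B *v v)\<bar> \<le> r * (v \<bullet> v)" for v
    using up[of v] m(2)[of v] c r unfolding Bv r_def by (auto simp: field_simps)
  then have B: "norm (B *v v) \<le> r * norm v" for v
    by (rule onorm_Sym_le[OF Bsym])
  define T where "T Y = (1/2) *\<^sub>R (B + Y ** Y)" for Y :: "real^'n^'n"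
  \<comment> \<open>The operator bound r does three things: T preserves it, it is the contraction
    rate of T, and it makes 1 - Y positive definite.\<close>
  define S :: "(real^'n^'n) set" where "S = {Y \<in> Sym. \<forall>v. norm (Y *v v) \<le> r * norm v}"
  have T: "T Y \<in> S" if "Y \<in> S" for Y :: "real^'n^'n"
  proof -
    have Y: "Y \<in> Sym" "\<And>v. norm (Y *v v) \<le> r * norm v" using that by (auto simp: S_def)
    have "norm (T Y *v v) \<le> r * norm v" for v
    proof -
      have "norm (Y *v (Y *v v)) \<le> r * (r * norm v)"
        using order_trans[OF Y(2)[of "Y *v v"] mult_left_mono[OF Y(2)[of v]]] r by simp
      also have "\<dots> \<le> r * norm v"
        using r by (simp add: mult_left_le_one_le)
      finally have "norm (Y *v (Y *v v)) \<le> r * norm v" .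
      then have "norm (B *v v + Y *v (Y *v v)) \<le> 2 * (r * norm v)"
        using B[of v] norm_triangle_ineq[of "B *v v" "Y *v (Y *v v)"] by linarith
      then show ?thesis
        by (simp add: T_def algebra_simps scaleR_matrix_vector_assoc[symmetric]
            matrix_vector_mul_assoc flip: scaleR_add_right)
    qed
    moreover have "T Y \<in> Sym"
      using Y(1) Bsym by (simp add: T_def Sym_def transpose_linear_simps matrix_transpose_mul)
    ultimately show ?thesis by (simp add: S_def)
  qed
  have contr: "dist (T Y) (T Z) \<le> r * dist Y Z" if "Y \<in> S" "Z \<in> S" for Y Z :: "real^'n^'n"
  proof -
    have Y: "Y \<in> Sym" "\<And>v. norm (Y *v v) \<le> r * norm v"
      and Z: "Z \<in> Sym" "\<And>v. norm (Z *v v) \<le> r * norm v" using that by (auto simp: S_def)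
    have "transpose (Y ** (Y - Z)) = (Y - Z) ** Y"
      using Y Z by (simp add: matrix_transpose_mul Sym_def transpose_linear_simps)
    then have "norm (Y ** (Y - Z)) = norm ((Y - Z) ** Y)"
      by (metis norm_transpose)
    then have 1: "norm (Y ** (Y - Z)) \<le> r * norm (Y - Z)"
      using norm_mult_Sym_le[OF Y, where D = "Y - Z"] r by simp
    have 2: "norm ((Y - Z) ** Z) \<le> r * norm (Y - Z)"
      using norm_mult_Sym_le[OF Z, where D = "Y - Z"] r by simp
    \<comment> \<open>Noncommutative form of the difference of squares: Y^2 - Z^2 = Y (Y - Z) + (Y -
      Z) Z.\<close>
    have "T Y - T Z = (1/2) *\<^sub>R (Y ** (Y - Z) + (Y - Z) ** Z)"
      by (simp add: T_def matrix_simps flip: scaleR_diff_right)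
    then have "norm (T Y - T Z) \<le> (r * norm (Y - Z) + r * norm (Y - Z)) / 2"
      using norm_triangle_le[OF add_mono[OF 1 2]] by simp
    then show ?thesis by (simp add: dist_norm)
  qed
  have "closed S"
  proof -
    have "S = Sym \<inter> (\<Inter>v. {Y. norm (Y *v v) \<le> r * norm v})"
      by (auto simp: S_def)
    moreover have "closed {Y :: real^'n^'n. norm (Y *v v) \<le> r * norm v}" for v
    proof (intro closed_Collect_le continuous_intros)
      have "bounded_linear (\<lambda>Y :: real^'n^'n. Y *v v)"
        by (auto simp: linear_conv_bounded_linear[symmetric] linear_iff algebra_simps
            scaleR_matrix_vector_assoc[symmetric])
      then show "continuous_on UNIV (\<lambda>Y :: real^'n^'n. Y *v v)"
        by (rule linear_continuous_on)
    qed
    ultimately show ?thesis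
      by (auto intro!: closed_Int closed_INT closed_subspace[OF subspace_Sym])
  qed
  moreover have "0 \<in> S"
    using r by (simp add: S_def subspace_0[OF subspace_Sym])
  ultimately obtain Y where Y: "Y \<in> S" "T Y = Y"
    using Banach_fix[where S = S and c = r and f = T] T contr r by (auto simp: complete_eq_closed)
  define X where "X = mat 1 - Y"
  have "X ** X = (1 / c) *\<^sub>R A"
  proof -
    have "2 *\<^sub>R ((1/2) *\<^sub>R (B + Y ** Y)) = 2 *\<^sub>R Y" using Y(2) by (simp only: T_def)
    then have "B + Y ** Y = 2 *\<^sub>R Y" by simp
    then show ?thesis by (simp add: X_def B_def matrix_simps algebra_simps scaleR_2)
  qed
  then have "(sqrt c *\<^sub>R X) ** (sqrt c *\<^sub>R X) = A"
    using c by (simp add: matrix_simps)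
  moreover have "sqrt c *\<^sub>R X \<in> SPD"
  proof -
    have "v \<bullet> (X *v v) > 0" if "v \<noteq> 0" for v
    proof -
      have "v \<bullet> (Y *v v) \<le> norm v * (r * norm v)"
        using Y(1) by (intro order_trans[OF norm_cauchy_schwarz] mult_left_mono) (auto simp: S_def)
      also have "\<dots> < v \<bullet> v"
        using that r by (simp add: dot_square_norm power2_eq_square)
      finally show ?thesis by (simp add: X_def algebra_simps inner_diff_right)
    qed
    moreover have "X \<in> Sym" using Y(1) by (simp add: S_def X_def Sym_def transpose_linear_simps)
    ultimately show ?thesis
      using c by (simp add: SPD_def subspace_scale[OF subspace_Sym] scaleR_matrix_vector_assoc[symmetric])
  qed
  ultimately show ?thesis using that by blast
qed

text \<open>With y the inverse square root of p, cyclicity of the trace turns the metric into the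
  squared Euclidean norm of y A y.\<close>

lemma metric_definite:
  assumes "p \<in> SPD" "A \<in> Sym" "metric p A A = 0"
  shows "A = 0"
proof -
  obtain x where x: "x \<in> SPD" "x ** x = p" using SPD_sqrt[OF assms(1)] by blast
  define y where "y = matrix_inv x"
  have xy: "x ** y = mat 1" "y ** x = mat 1"
    using matrix_inv[OF SPD_invertible[OF x(1)]] by (auto simp: y_def)
  have "p ** (y ** y) = mat 1"
    by (simp add: x(2)[symmetric] matrix_mul_assoc) (simp add: matrix_mul_assoc[symmetric] xy)
  then have p: "matrix_inv p = y ** y" by (rule matrix_inv_unique)
  have ysym: "transpose y = y"
    using matrix_inv_Sym[OF SPD_Sym[OF x(1)] SPD_invertible[OF x(1)]] by (simp add: y_def Sym_def)
  define B where "B = y ** A ** y"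
  have "transpose B = B"
    using assms(2) by (simp add: B_def matrix_transpose_mul ysym Sym_def matrix_mul_assoc)
  have "metric p A A = trace (y ** (y ** A ** y ** y ** A))"
    by (simp add: metric_def p matrix_mul_assoc)
  also have "\<dots> = trace (B ** B)"
    by (subst trace_mul_sym) (simp add: B_def matrix_mul_assoc)
  also have "\<dots> = B \<bullet> B"
    by (simp add: trace_eq_inner \<open>transpose B = B\<close>)
  finally have "B = 0" using assms(3) by simp
  have "A = x ** B ** x"
    by (simp add: B_def matrix_mul_assoc xy) (simp add: matrix_mul_assoc[symmetric] xy)
  with \<open>B = 0\<close> show ?thesis by simp
qed


section \<open>Differential calculus\<close>

abbreviation C2_on :: "'a::euclidean_space set \<Rightarrow> ('a \<Rightarrow> 'b::euclidean_space) \<Rightarrow> bool" where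
  "C2_on \<equiv> Ck_on (Suc (Suc 0))"

abbreviation fder :: "('a::real_normed_vector \<Rightarrow> 'b::real_normed_vector) \<Rightarrow> 'a \<Rightarrow> 'a \<Rightarrow> 'b" where
  "fder f x v \<equiv> frechet_derivative f (at x) v"

text \<open>Differentiation along \<open>u\<close> comes first, then along \<open>v\<close>;
  linearity in \<open>v\<close> is immediate, linearity in \<open>u\<close> needs the symmetry
  proved below.\<close>

definition fder2 :: "('a::real_normed_vector \<Rightarrow> 'b::real_normed_vector) \<Rightarrow> 'a \<Rightarrow> 'a \<Rightarrow> 'a \<Rightarrow> 'b" where
  "fder2 f x u v = fder (\<lambda>y. fder f y u) x v"

lemma smooth_on_C2E:
  assumes "smooth_on S f" "x \<in> S"
  obtains W g where "open W" "x \<in> W" "C2_on W g" "\<And>y. y \<in> S \<Longrightarrow> y \<in> W \<Longrightarrow> g y = f y"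
  using assms unfolding smooth_on_def by (metis IntI)

lemma C2_on_fder:
  assumes "C2_on W f" "x \<in> W"
  shows "(f has_derivative fder f x) (at x)"
  using assms by (auto simp: frechet_derivative_works)

lemma C2_on_fder2:
  assumes "C2_on W f" "x \<in> W"
  shows "((\<lambda>y. fder f y u) has_derivative fder2 f x u) (at x)"
  using assms by (auto simp: frechet_derivative_works fder2_def[abs_def])

lemma C2_on_continuous_fder2:
  assumes "C2_on W f"
  shows "continuous_on W (\<lambda>x. fder2 f x u v)"
  using assms by (simp add: fder2_def)

lemma linear_fder: "C2_on W f \<Longrightarrow> x \<in> W \<Longrightarrow> linear (fder f x)"
  using has_derivative_linear[OF C2_on_fder] by blast

lemma linear_fder2: "C2_on W f \<Longrightarrow> x \<in> W \<Longrightarrow> linear (fder2 f x u)"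
  using has_derivative_linear[OF C2_on_fder2] by blast

text \<open>The mean value theorem is applied once along u and once along v; pairing with k makes
  the functions real-valued.\<close>

lemma second_difference:
  fixes f :: "'a::euclidean_space \<Rightarrow> 'b::euclidean_space"
  assumes f: "C2_on W f" and h: "h > 0"
    and W: "\<And>s t. 0 \<le> s \<Longrightarrow> s \<le> h \<Longrightarrow> 0 \<le> t \<Longrightarrow> t \<le> h \<Longrightarrow> x + s *\<^sub>R u + t *\<^sub>R v \<in> W"
  obtains s t where "0 < s" "s < h" "0 < t" "t < h"
    "(f (x + h *\<^sub>R u + h *\<^sub>R v) - f (x + h *\<^sub>R u) - f (x + h *\<^sub>R v) + f x) \<bullet> k =
      h * h * (fder2 f (x + s *\<^sub>R u + t *\<^sub>R v) u v \<bullet> k)"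
proof -
  define \<phi> where "\<phi> s = (f (x + s *\<^sub>R u + h *\<^sub>R v) - f (x + s *\<^sub>R u)) \<bullet> k" for s
  define \<phi>' where "\<phi>' s = (fder f (x + s *\<^sub>R u + h *\<^sub>R v) u - fder f (x + s *\<^sub>R u) u) \<bullet> k" for s
  have line: "((\<lambda>s. f (y + s *\<^sub>R u)) has_derivative (\<lambda>r. r *\<^sub>R fder f (y + s *\<^sub>R u) u)) (at s)"
    if "y + s *\<^sub>R u \<in> W" for y s
  proof -
    have "((\<lambda>s. y + s *\<^sub>R u) has_derivative (\<lambda>r. r *\<^sub>R u)) (at s)"
      by (auto intro!: derivative_eq_intros)
    from has_derivative_compose[OF this C2_on_fder[OF f that]]
    show ?thesis by (simp add: linear_cmul[OF linear_fder[OF f that]])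
  qed
  have \<phi>: "(\<phi> has_real_derivative \<phi>' s) (at s)" if s: "0 \<le> s" "s \<le> h" for s
  proof -
    have "x + h *\<^sub>R v + s *\<^sub>R u \<in> W" "x + s *\<^sub>R u \<in> W"
      using W[OF s, of h] W[OF s, of 0] h by (simp_all add: ac_simps)
    note l = line[OF this(1)] line[OF this(2)]
    show ?thesis
      unfolding has_field_derivative_def \<phi>_def[abs_def] \<phi>'_def
      by (rule has_derivative_eq_rhs[OF has_derivative_inner_left[OF has_derivative_diff]])
         (use l in \<open>auto simp: ac_simps algebra_simps inner_diff_left fun_eq_iff\<close>)
  qed
  obtain s where s: "0 < s" "s < h" "\<phi> h - \<phi> 0 = (h - 0) * \<phi>' s"
    using MVT2[of 0 h \<phi> \<phi>'] \<phi> h by auto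
  define g where "g t = fder f (x + s *\<^sub>R u + t *\<^sub>R v) u \<bullet> k" for t
  define g' where "g' t = fder2 f (x + s *\<^sub>R u + t *\<^sub>R v) u v \<bullet> k" for t
  have g: "(g has_real_derivative g' t) (at t)" if t: "0 \<le> t" "t \<le> h" for t
  proof -
    have w: "x + s *\<^sub>R u + t *\<^sub>R v \<in> W" using W[of s t] s t by simp
    have "((\<lambda>t. x + s *\<^sub>R u + t *\<^sub>R v) has_derivative (\<lambda>r. r *\<^sub>R v)) (at t)"
      by (auto intro!: derivative_eq_intros)
    from has_derivative_inner_left[OF has_derivative_compose[OF this C2_on_fder2[OF f w, of u]], of k]
    show ?thesis
      by (simp add: has_field_derivative_def g_def[abs_def] g'_def linear_cmul[OF linear_fder2[OF f w]]
         mult.commute[of _ "fder2 _ _ _ _ \<bullet> k"])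
  qed
  obtain t where t: "0 < t" "t < h" "g h - g 0 = (h - 0) * g' t"
    using MVT2[of 0 h g g'] g h by auto
  have "\<phi>' s = g h - g 0"
    by (simp add: \<phi>'_def g_def inner_diff_left)
  with s t have "\<phi> h - \<phi> 0 = h * h * g' t" by simp
  moreover have "\<phi> h - \<phi> 0 = (f (x + h *\<^sub>R u + h *\<^sub>R v) - f (x + h *\<^sub>R u) - f (x + h *\<^sub>R v) + f x) \<bullet> k"
    by (simp add: \<phi>_def inner_diff_left inner_add_left)
  ultimately show ?thesis
    using that[OF s(1,2) t(1,2)] by (simp add: g'_def)
qed

text \<open>Schwarz's theorem: the second difference is symmetric in u and v and equals h^2 times
  either mixed derivative at points near x, so continuity forces equality at x.\<close>

lemma fder2_symmetric:
  fixes f :: "'a::euclidean_space \<Rightarrow> 'b::euclidean_space"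
  assumes f: "C2_on W f" and W: "open W" "x \<in> W"
  shows "fder2 f x u v = fder2 f x v u"
proof (rule euclidean_eqI)
  fix k :: 'b
  let ?a = "fder2 f x u v \<bullet> k" and ?b = "fder2 f x v u \<bullet> k"
  have cont: "((\<lambda>y. fder2 f y a b \<bullet> k) \<longlongrightarrow> fder2 f x a b \<bullet> k) (at x)" for a b
    using C2_on_continuous_fder2[OF f, of a b] W
    by (intro tendsto_intros) (simp add: continuous_on_eq_continuous_at isCont_def)
  have ev: "\<forall>\<^sub>F y in at x. y \<in> W" using W by (simp add: eventually_at_in_open')
  show "?a = ?b"
  proof (rule ccontr)
    assume "?a \<noteq> ?b"
    define e where "e = \<bar>?a - ?b\<bar> / 2"
    have "e > 0" using \<open>?a \<noteq> ?b\<close> by (simp add: e_def)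
    have "\<forall>\<^sub>F y in at x. y \<in> W \<and> dist (fder2 f y u v \<bullet> k) ?a < e \<and> dist (fder2 f y v u \<bullet> k) ?b < e"
      using ev tendstoD[OF cont \<open>e > 0\<close>] tendstoD[OF cont \<open>e > 0\<close>] by (intro eventually_conj) 
    then obtain d where d: "d > 0" "\<And>y. y \<noteq> x \<Longrightarrow> dist y x < d \<Longrightarrow>
        y \<in> W \<and> dist (fder2 f y u v \<bullet> k) ?a < e \<and> dist (fder2 f y v u \<bullet> k) ?b < e"
      by (auto simp: eventually_at)
    have d: "y \<in> W" "dist (fder2 f y u v \<bullet> k) ?a < e" "dist (fder2 f y v u \<bullet> k) ?b < e"
      if "dist y x < d" for y
      using d(2)[OF _ that] W(2) \<open>e > 0\<close> by (cases "y = x"; simp)+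
    \<comment> \<open>With this h the whole parallelogram spanned by h u and h v at x stays within
      distance d.\<close>
    obtain h where h: "h > 0" "h * (norm u + norm v + 1) < d"
      using d(1) \<open>d > 0\<close> by (intro that[of "d / (2 * (norm u + norm v + 1))"])
        (auto simp: field_simps add_pos_nonneg intro!: divide_pos_pos add_nonneg_pos)
    have near: "dist (x + s *\<^sub>R a + t *\<^sub>R b) x < d"
      if "0 \<le> s" "s \<le> h" "0 \<le> t" "t \<le> h" "norm a + norm b \<le> norm u + norm v" for s t a b
    proof -
      have "dist (x + s *\<^sub>R a + t *\<^sub>R b) x = norm (s *\<^sub>R a + t *\<^sub>R b)"
        by (simp add: dist_norm)
      also have "\<dots> \<le> s * norm a + t * norm b"
        using norm_triangle_ineq[of "s *\<^sub>R a" "t *\<^sub>R b"] that by simp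
      also have "\<dots> \<le> h * norm a + h * norm b"
        using that by (intro add_mono mult_right_mono) auto
      also have "\<dots> \<le> h * (norm u + norm v + 1)"
        using that h by (simp flip: distrib_left)
      finally show ?thesis using h by simp
    qed
    have uv: "x + s *\<^sub>R u + t *\<^sub>R v \<in> W" and vu: "x + s *\<^sub>R v + t *\<^sub>R u \<in> W"
      if "0 \<le> s" "s \<le> h" "0 \<le> t" "t \<le> h" for s t
      using that by (auto intro!: d(1) near)
    obtain s t where st: "0 < s" "s < h" "0 < t" "t < h"
      "(f (x + h *\<^sub>R u + h *\<^sub>R v) - f (x + h *\<^sub>R u) - f (x + h *\<^sub>R v) + f x) \<bullet> k =
        h * h * (fder2 f (x + s *\<^sub>R u + t *\<^sub>R v) u v \<bullet> k)"
      by (rule second_difference[OF f h(1) uv])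
    obtain s' t' where st': "0 < s'" "s' < h" "0 < t'" "t' < h"
      "(f (x + h *\<^sub>R v + h *\<^sub>R u) - f (x + h *\<^sub>R v) - f (x + h *\<^sub>R u) + f x) \<bullet> k =
        h * h * (fder2 f (x + s' *\<^sub>R v + t' *\<^sub>R u) v u \<bullet> k)"
      by (rule second_difference[OF f h(1) vu])
    have "h * h * (fder2 f (x + s *\<^sub>R u + t *\<^sub>R v) u v \<bullet> k) = h * h * (fder2 f (x + s' *\<^sub>R v + t' *\<^sub>R u) v u \<bullet> k)"
      unfolding st(5)[symmetric] st'(5)[symmetric] by (simp add: ac_simps algebra_simps)
    then have "fder2 f (x + s *\<^sub>R u + t *\<^sub>R v) u v \<bullet> k = fder2 f (x + s' *\<^sub>R v + t' *\<^sub>R u) v u \<bullet> k"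
      using h by simp
    moreover have "dist (fder2 f (x + s *\<^sub>R u + t *\<^sub>R v) u v \<bullet> k) ?a < e"
      using st by (intro d near) auto
    moreover have "dist (fder2 f (x + s' *\<^sub>R v + t' *\<^sub>R u) v u \<bullet> k) ?b < e"
      using st' by (intro d near) auto
    ultimately have "dist ?a ?b < \<bar>?a - ?b\<bar>"
      using dist_triangle_half_r unfolding e_def by metis
    then show False by (simp add: dist_real_def)
  qed
qed

lemma fder_expand:
  fixes f :: "'a::euclidean_space \<Rightarrow> 'b::euclidean_space"
  assumes "C2_on W f" "x \<in> W"
  shows "fder f x v = (\<Sum>b\<in>Basis. (v \<bullet> b) *\<^sub>R fder f x b)"
  using linear_sum[OF linear_fder[OF assms], of "\<lambda>b. (v \<bullet> b) *\<^sub>R b" Basis]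
  by (simp add: euclidean_representation linear_cmul[OF linear_fder[OF assms]])

lemma fder2_expand:
  fixes f :: "'a::euclidean_space \<Rightarrow> 'b::euclidean_space"
  assumes "C2_on W f" "open W" "x \<in> W"
  shows "fder2 f x u v = (\<Sum>b\<in>Basis. (u \<bullet> b) *\<^sub>R fder2 f x b v)"
proof -
  have "fder2 f x u v = fder2 f x v u" by (rule fder2_symmetric[OF assms])
  also have "\<dots> = (\<Sum>b\<in>Basis. (u \<bullet> b) *\<^sub>R fder2 f x v b)"
    using linear_sum[OF linear_fder2[OF assms(1,3)], of v "\<lambda>b. (u \<bullet> b) *\<^sub>R b" Basis]
    by (simp add: euclidean_representation linear_cmul[OF linear_fder2[OF assms(1,3)]])
  finally show ?thesis by (simp add: fder2_symmetric[OF assms, of v])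
qed

section \<open>Second-order calculus along curves\<close>

lemma fder_curve:
  assumes "(c has_vector_derivative c') (at t within I)" "C2_on W f" "c t \<in> W"
  shows "((\<lambda>s. f (c s)) has_vector_derivative fder f (c t) c') (at t within I)"
  using has_derivative_compose[OF assms(1)[unfolded has_vector_derivative_def] C2_on_fder[OF assms(2,3)]]
  by (simp add: has_vector_derivative_def linear_cmul[OF linear_fder[OF assms(2,3)]])

lemma fder2_curve:
  assumes "(c has_vector_derivative c') (at t within I)" "C2_on W f" "c t \<in> W"
  shows "((\<lambda>s. fder f (c s) u) has_vector_derivative fder2 f (c t) u c') (at t within I)"
  using has_derivative_compose[OF assms(1)[unfolded has_vector_derivative_def] C2_on_fder2[OF assms(2,3)]]
  by (simp add: has_vector_derivative_def linear_cmul[OF linear_fder2[OF assms(2,3)]])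

lemma has_vector_derivative_eventually_in:
  assumes "(c has_vector_derivative c') (at t within I)" "open W" "c t \<in> W"
  obtains T where "open T" "t \<in> T" "\<And>s. s \<in> I \<Longrightarrow> s \<in> T \<Longrightarrow> c s \<in> W"
proof -
  have "(c \<longlongrightarrow> c t) (at t within I)"
    using has_vector_derivative_continuous[OF assms(1)] by (simp add: continuous_within)
  from topological_tendstoD[OF this assms(2,3)] obtain T where
    "open T" "t \<in> T" "\<And>s. s \<in> T \<Longrightarrow> s \<noteq> t \<Longrightarrow> s \<in> I \<Longrightarrow> c s \<in> W"
    by (auto simp: eventually_at_topological)
  with assms(3) that show ?thesis by metis
qed

lemma has_vector_derivative_transform_open:
  assumes "(f has_vector_derivative f') (at t within I)" "open T" "t \<in> T" "t \<in> I"
    "\<And>s. s \<in> I \<Longrightarrow> s \<in> T \<Longrightarrow> f s = g s"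
  shows "(g has_vector_derivative f') (at t within I)"
proof -
  obtain d where "d > 0" "ball t d \<subseteq> T" using assms(2,3) open_contains_ball by blast
  then show ?thesis
    by (intro has_vector_derivative_transform_within[OF assms(1) \<open>d > 0\<close> assms(4)])
       (use assms(5) in \<open>auto simp: subset_iff dist_commute\<close>)
qed

text \<open>\<open>Ck_on\<close> differentiates \<open>fder f\<close> only in a fixed direction.
  Expanding the moving direction \<open>c1 s\<close> in the basis reduces the claim to that case and
  the product rule.\<close>

lemma fder_curve_derivative:
  fixes f :: "'a::euclidean_space \<Rightarrow> 'b::euclidean_space"
  assumes c: "(c has_vector_derivative c1 t) (at t within I)"
    and c1: "(c1 has_vector_derivative c2) (at t within I)"
    and f: "C2_on W f" "open W" "c t \<in> W" and t: "t \<in> I"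
  shows "((\<lambda>s. fder f (c s) (c1 s)) has_vector_derivative
    fder2 f (c t) (c1 t) (c1 t) + fder f (c t) c2) (at t within I)"
proof -
  obtain T where T: "open T" "t \<in> T" "\<And>s. s \<in> I \<Longrightarrow> s \<in> T \<Longrightarrow> c s \<in> W"
    using has_vector_derivative_eventually_in[OF c f(2,3)] by blast
  have inner: "((\<lambda>s. c1 s \<bullet> b) has_real_derivative c2 \<bullet> b) (at t within I)" for b
    using bounded_linear.has_vector_derivative[OF bounded_linear_inner_left c1]
    by (simp add: has_real_derivative_iff_has_vector_derivative)
  have "((\<lambda>s. \<Sum>b\<in>Basis. (c1 s \<bullet> b) *\<^sub>R fder f (c s) b) has_vector_derivative
     (\<Sum>b\<in>Basis. (c1 t \<bullet> b) *\<^sub>R fder2 f (c t) b (c1 t) + (c2 \<bullet> b) *\<^sub>R fder f (c t) b)) (at t within I)"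
    by (intro has_vector_derivative_sum has_vector_derivative_scaleR inner fder2_curve[OF c f(1,3)])
  also have "(\<Sum>b\<in>Basis. (c1 t \<bullet> b) *\<^sub>R fder2 f (c t) b (c1 t) + (c2 \<bullet> b) *\<^sub>R fder f (c t) b) =
      fder2 f (c t) (c1 t) (c1 t) + fder f (c t) c2"
    by (subst (2) fder2_expand[OF f]) (simp add: sum.distrib fder_expand[OF f(1,3), symmetric])
  finally show ?thesis
    by (rule has_vector_derivative_transform_open[OF _ T(1,2) t])
       (use T(3) fder_expand[OF f(1), symmetric] in auto)
qed

text \<open>Velocity near \<open>t\<close> and acceleration at \<open>t\<close>, relative to
  \<open>I\<close>. As a relation it passes through compositions and local changes of the curve, and
  one-sided derivatives at end points need no separate treatment.\<close>

definition curve_jet ::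
  "real set \<Rightarrow> (real \<Rightarrow> 'a::real_normed_vector) \<Rightarrow> real \<Rightarrow> (real \<Rightarrow> 'a) \<Rightarrow> 'a \<Rightarrow> bool" where
  "curve_jet I c t c1 c2 \<longleftrightarrow> t \<in> I \<and> (c1 has_vector_derivative c2) (at t within I) \<and>
     (\<exists>T. open T \<and> t \<in> T \<and> (\<forall>s\<in>I \<inter> T. (c has_vector_derivative c1 s) (at s within I)))"

text \<open>This makes one-sided derivatives unique: a point of a convex set with interior points is
  a limit of interior points.\<close>

lemma interval_at_within_not_bot:
  fixes I :: "real set"
  assumes "is_interval I" "interior I \<noteq> {}" "t \<in> I"
  shows "at t within I \<noteq> bot"
proof -
  have "closure I = closure (interior I)"
    using assms convex_closure_interior is_interval_convex by blast
  then have "t islimpt closure I"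
    using assms(3) closure_subset by (intro islimpt_closure_open[of "interior I"]) auto
  then show ?thesis
    by (simp add: trivial_limit_within limpt_of_closure)
qed

lemma curve_jet_first: "curve_jet I c t c1 c2 \<Longrightarrow> (c has_vector_derivative c1 t) (at t within I)"
  by (auto simp: curve_jet_def)

lemma curve_jet_vector_derivative:
  assumes "curve_jet I c t c1 c2" "is_interval I" "interior I \<noteq> {}"
  shows "vector_derivative c (at t within I) = c1 t"
    and "vector_derivative (\<lambda>s. vector_derivative c (at s within I)) (at t within I) = c2"
    and "curve_jet I c t (\<lambda>s. vector_derivative c (at s within I)) c2"
proof -
  note nb = interval_at_within_not_bot[OF assms(2,3)]
  from assms(1) obtain T where T: "open T" "t \<in> T" "t \<in> I"
    and c1: "(c1 has_vector_derivative c2) (at t within I)"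
    and c: "\<And>s. s \<in> I \<Longrightarrow> s \<in> T \<Longrightarrow> (c has_vector_derivative c1 s) (at s within I)"
    by (auto simp: curve_jet_def)
  have eq: "vector_derivative c (at s within I) = c1 s" if "s \<in> I" "s \<in> T" for s
    using vector_derivative_within[OF nb[OF that(1)] c[OF that]] .
  show "vector_derivative c (at t within I) = c1 t" using eq T by blast
  have "((\<lambda>s. vector_derivative c (at s within I)) has_vector_derivative c2) (at t within I)"
    by (rule has_vector_derivative_transform_open[OF c1 T]) (simp add: eq)
  then show "vector_derivative (\<lambda>s. vector_derivative c (at s within I)) (at t within I) = c2"
    and "curve_jet I c t (\<lambda>s. vector_derivative c (at s within I)) c2"
    using T c by (auto simp: curve_jet_def eq intro!: vector_derivative_within[OF nb[OF T(3)]])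
qed

lemma curve_jet_unique:
  assumes "curve_jet I c t c1 c2" "curve_jet I c t d1 d2" "is_interval I" "interior I \<noteq> {}"
  shows "c1 t = d1 t" "c2 = d2"
  using curve_jet_vector_derivative[OF assms(1,3,4)] curve_jet_vector_derivative[OF assms(2,3,4)]
  by simp_all

lemma curve_jet_transform:
  assumes "curve_jet I c t c1 c2" "open T" "t \<in> T" "\<And>s. s \<in> I \<Longrightarrow> s \<in> T \<Longrightarrow> c s = d s"
  shows "curve_jet I d t c1 c2"
proof -
  from assms(1) obtain P where P: "open P" "t \<in> P" "t \<in> I"
    and c1: "(c1 has_vector_derivative c2) (at t within I)"
    and c: "\<And>s. s \<in> I \<Longrightarrow> s \<in> P \<Longrightarrow> (c has_vector_derivative c1 s) (at s within I)"
    by (auto simp: curve_jet_def)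
  have "(d has_vector_derivative c1 s) (at s within I)" if "s \<in> I" "s \<in> T" "s \<in> P" for s
    using has_vector_derivative_transform_open[OF c[OF that(1,3)] assms(2) that(2,1) assms(4)] .
  with P c1 show ?thesis
    unfolding curve_jet_def using assms(2,3)
    by (intro conjI exI[of _ "T \<inter> P"]) auto
qed

lemma curve_jet_compose:
  fixes f :: "'a::euclidean_space \<Rightarrow> 'b::euclidean_space"
  assumes "curve_jet I c t c1 c2" and f: "C2_on W f" "open W" "c t \<in> W"
  shows "curve_jet I (\<lambda>s. f (c s)) t (\<lambda>s. fder f (c s) (c1 s))
    (fder2 f (c t) (c1 t) (c1 t) + fder f (c t) c2)"
proof -
  from assms(1) obtain P where P: "open P" "t \<in> P" "t \<in> I"
    and c1: "(c1 has_vector_derivative c2) (at t within I)"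
    and c: "\<And>s. s \<in> I \<Longrightarrow> s \<in> P \<Longrightarrow> (c has_vector_derivative c1 s) (at s within I)"
    by (auto simp: curve_jet_def)
  obtain T where T: "open T" "t \<in> T" "\<And>s. s \<in> I \<Longrightarrow> s \<in> T \<Longrightarrow> c s \<in> W"
    using has_vector_derivative_eventually_in[OF c[OF P(3,2)] f(2,3)] by blast
  show ?thesis
    unfolding curve_jet_def
    using fder_curve_derivative[OF c[OF P(3,2)] c1 f P(3)] fder_curve[OF c f(1)] T P
    by (intro conjI exI[of _ "T \<inter> P"]) auto
qed

lemma Ck_on_id: "Ck_on k W (\<lambda>x. x)"
proof -
  have "Ck_on k W (\<lambda>x. c)" for k W and c :: "'b::euclidean_space"
    by (induction k arbitrary: c) auto
  then show ?thesis
    by (cases k) (auto simp: continuous_on_id)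
qed

lemma smooth_curve_jet:
  fixes c :: "real \<Rightarrow> 'a::euclidean_space"
  assumes "smooth_on I c" "t \<in> I"
  obtains c1 c2 where "curve_jet I c t c1 c2"
proof -
  obtain W g where W: "open W" "t \<in> W" "C2_on W g" "\<And>s. s \<in> I \<Longrightarrow> s \<in> W \<Longrightarrow> g s = c s"
    using smooth_on_C2E[OF assms] by blast
  have "curve_jet I (\<lambda>s. s) t (\<lambda>s. 1) 0"
    using assms(2) by (auto simp: curve_jet_def intro!: exI[of _ UNIV] derivative_eq_intros)
  from curve_jet_transform[OF curve_jet_compose[OF this W(3,1,2)] W(1,2,4)]
  show ?thesis using that by blast
qed

lemma has_vector_derivative_subspace:
  fixes L :: "'a::euclidean_space set"
  assumes "subspace L" "(c has_vector_derivative c') (at t within I)" "at t within I \<noteq> bot"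
    "open T" "t \<in> T" "t \<in> I" "\<And>s. s \<in> I \<Longrightarrow> s \<in> T \<Longrightarrow> c s \<in> L"
  shows "c' \<in> L"
proof (rule Lim_in_closed_set[OF closed_subspace[OF assms(1)] _ assms(3)
      assms(2)[unfolded has_vector_derivative_iff_slope]])
  have "\<forall>\<^sub>F s in at t within I. s \<in> T \<and> s \<in> I"
    using assms(4,5) by (auto simp: eventually_at_topological)
  then show "\<forall>\<^sub>F s in at t within I. (c s - c t) /\<^sub>R (s - t) \<in> L"
    by eventually_elim (use assms in \<open>auto intro: subspace_scale subspace_diff\<close>)
qed

lemma curve_jet_subspace:
  fixes L :: "'a::euclidean_space set"
  assumes L: "subspace L" and "curve_jet I c t c1 c2" "is_interval I" "interior I \<noteq> {}"
    and T: "open T" "t \<in> T" "\<And>s. s \<in> I \<Longrightarrow> s \<in> T \<Longrightarrow> c s \<in> L"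
  shows "c1 t \<in> L" "c2 \<in> L"
proof -
  from assms(2) obtain P where P: "open P" "t \<in> P" "t \<in> I"
    and c1: "(c1 has_vector_derivative c2) (at t within I)"
    and c: "\<And>s. s \<in> I \<Longrightarrow> s \<in> P \<Longrightarrow> (c has_vector_derivative c1 s) (at s within I)"
    by (auto simp: curve_jet_def)
  note nb = interval_at_within_not_bot[OF assms(3,4)]
  have *: "c1 s \<in> L" if "s \<in> I" "s \<in> T \<inter> P" for s
    using that by (intro has_vector_derivative_subspace[OF L c nb T(1)] T(3)) auto
  show "c1 t \<in> L" using * P T by blast
  show "c2 \<in> L"
    by (rule has_vector_derivative_subspace[OF L c1 nb[OF P(3)] open_Int[OF T(1) P(1)] _ P(3) *])
       (use T P in auto)
qed


section \<open>The geodesic equation in a slice chart\<close>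

text \<open>\<open>Sym\<close> is in general not open in the matrix space, so a chart map has no
  Frechet derivative of its own; derivatives are taken of an extension to an open set.\<close>

definition C2_ext :: "'a::euclidean_space set \<Rightarrow> ('a \<Rightarrow> 'b::euclidean_space) \<Rightarrow> 'a set \<Rightarrow> ('a \<Rightarrow> 'b) \<Rightarrow> bool" where
  "C2_ext S f W g \<longleftrightarrow> open W \<and> C2_on W g \<and> (\<forall>y\<in>S \<inter> W. g y = f y)"

lemma smooth_on_C2_ext:
  assumes "smooth_on S f" "x \<in> S"
  obtains W g where "C2_ext S f W g" "x \<in> W"
  using smooth_on_C2E[OF assms] unfolding C2_ext_def by (metis IntE)

lemma slice_chartD:
  assumes "slice_chart N U V \<phi> \<psi> L"
  shows "U \<subseteq> SPD" "openin (top_of_set Sym) U" "openin (top_of_set Sym) V"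
    "\<And>u. u \<in> U \<Longrightarrow> \<phi> u \<in> V" "\<And>u. u \<in> U \<Longrightarrow> \<psi> (\<phi> u) = u"
    "\<And>v. v \<in> V \<Longrightarrow> \<psi> v \<in> U" "\<And>v. v \<in> V \<Longrightarrow> \<phi> (\<psi> v) = v"
    "smooth_on U \<phi>" "smooth_on V \<psi>" "subspace L" "L \<subseteq> Sym" "\<phi> ` (N \<inter> U) = V \<inter> L"
  using assms unfolding slice_chart_def homeomorphism_def by blast+

lemma openin_line:
  fixes w v :: "real^'n^'n"
  assumes "openin (top_of_set Sym) V" "open W" "w \<in> V" "w \<in> W" "v \<in> Sym"
  obtains T where "open T" "(0::real) \<in> T" "\<And>t. t \<in> T \<Longrightarrow> w + t *\<^sub>R v \<in> V \<and> w + t *\<^sub>R v \<in> W"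
proof -
  obtain V0 where V0: "open V0" "V = Sym \<inter> V0"
    using assms(1) by (auto simp: openin_open)
  define T where "T = (\<lambda>t::real. w + t *\<^sub>R v) -` (V0 \<inter> W)"
  have "open T"
    unfolding T_def using V0 assms(2) by (intro open_vimage continuous_intros open_Int) auto
  moreover have "w + t *\<^sub>R v \<in> Sym" for t
    using assms V0 by (auto intro: subspace_add subspace_scale subspace_Sym)
  ultimately show ?thesis
    using that[of T] V0 assms by (auto simp: T_def)
qed

text \<open>Lines in symmetric directions stay in V for small times, so along them the extension and
  \<psi> have the same derivative, whatever the extension does off \<open>Sym\<close>.\<close>

lemma local_metric_eq:
  assumes V: "openin (top_of_set Sym) V" and \<Psi>: "C2_ext V \<psi> W \<Psi>" "w \<in> V" "w \<in> W"
    and "a \<in> Sym" "b \<in> Sym"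
  shows "local_metric \<psi> w a b = metric (\<Psi> w) (fder \<Psi> w a) (fder \<Psi> w b)"
proof -
  have "vector_derivative (\<lambda>t. \<psi> (w + t *\<^sub>R v)) (at 0) = fder \<Psi> w v" if v: "v \<in> Sym" for v
  proof -
    obtain T where T: "open T" "(0::real) \<in> T" "\<And>t. t \<in> T \<Longrightarrow> w + t *\<^sub>R v \<in> V \<and> w + t *\<^sub>R v \<in> W"
      using openin_line[OF V _ \<Psi>(2,3) v] \<Psi>(1) unfolding C2_ext_def by blast
    have "((\<lambda>t. w + t *\<^sub>R v) has_vector_derivative v) (at 0 within UNIV)"
      by (auto intro!: derivative_eq_intros)
    moreover have "C2_on W \<Psi>" "w + 0 *\<^sub>R v \<in> W" using \<Psi> by (simp_all add: C2_ext_def)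
    ultimately have "((\<lambda>t. \<Psi> (w + t *\<^sub>R v)) has_vector_derivative fder \<Psi> (w + 0 *\<^sub>R v) v) (at 0 within UNIV)"
      by (rule fder_curve)
    then have "((\<lambda>t. \<Psi> (w + t *\<^sub>R v)) has_vector_derivative fder \<Psi> w v) (at 0 within UNIV)"
      by simp
    from has_vector_derivative_transform_open[OF this T(1,2)] T(3) \<Psi>(1)
    show ?thesis by (auto simp: C2_ext_def intro!: vector_derivative_at)
  qed
  then show ?thesis
    using assms by (simp add: local_metric_def Let_def C2_ext_def)
qed

lemma metric_deriv_local_metric:
  assumes V: "openin (top_of_set Sym) V" and \<Psi>: "C2_ext V \<psi> W \<Psi>" "w \<in> V" "w \<in> W"
    and "v \<in> Sym" "a \<in> Sym" "b \<in> Sym" and inv: "invertible (\<Psi> w)"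
  defines "Q \<equiv> matrix_inv (\<Psi> w)"
  shows "metric_deriv (local_metric \<psi>) w v a b =
     trace (Q ** fder2 \<Psi> w a v ** Q ** fder \<Psi> w b) + trace (Q ** fder \<Psi> w a ** Q ** fder2 \<Psi> w b v)
     - trace (Q ** fder \<Psi> w v ** Q ** fder \<Psi> w a ** Q ** fder \<Psi> w b)
     - trace (Q ** fder \<Psi> w a ** Q ** fder \<Psi> w v ** Q ** fder \<Psi> w b)"
proof -
  obtain T where T: "open T" "(0::real) \<in> T" "\<And>t. t \<in> T \<Longrightarrow> w + t *\<^sub>R v \<in> V \<and> w + t *\<^sub>R v \<in> W"
    using openin_line[OF V _ \<Psi>(2,3) \<open>v \<in> Sym\<close>] \<Psi>(1) unfolding C2_ext_def by blast
  have C2: "C2_on W \<Psi>" using \<Psi>(1) by (simp add: C2_ext_def)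
  have line: "((\<lambda>t. w + t *\<^sub>R v) has_vector_derivative v) (at 0 within UNIV)"
    by (auto intro!: derivative_eq_intros)
  have w0: "w + 0 *\<^sub>R v = w" "w + 0 *\<^sub>R v \<in> W" using \<Psi> by auto
  note d = fder_curve[OF line C2 w0(2), unfolded w0(1)]
    fder2_curve[OF line C2 w0(2), of a, unfolded w0(1)] fder2_curve[OF line C2 w0(2), of b, unfolded w0(1)]
  have inv': "invertible (\<Psi> (w + 0 *\<^sub>R v))" using inv by simp
  note D = has_vector_derivative_metric[OF d inv', unfolded w0(1), folded Q_def]
  have "((\<lambda>t. local_metric \<psi> (w + t *\<^sub>R v) a b) has_vector_derivative
     trace (Q ** fder2 \<Psi> w a v ** Q ** fder \<Psi> w b) + trace (Q ** fder \<Psi> w a ** Q ** fder2 \<Psi> w b v)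
     - trace (Q ** fder \<Psi> w v ** Q ** fder \<Psi> w a ** Q ** fder \<Psi> w b)
     - trace (Q ** fder \<Psi> w a ** Q ** fder \<Psi> w v ** Q ** fder \<Psi> w b)) (at 0 within UNIV)"
    by (rule has_vector_derivative_transform_open[OF D T(1,2)])
       (use local_metric_eq[OF V \<Psi>(1)] T(3) assms(6,7) in auto)
  then show ?thesis
    unfolding metric_deriv_def by (intro DERIV_imp_deriv) (simp add: has_real_derivative_iff_has_vector_derivative)
qed

text \<open>
  With constant coefficient fields, Koszul's formula for the pulled back metric yields the
  Christoffel symbol of the affine-invariant metric plus the second derivative of the parametrization.
\<close>

lemma local_geodesic_expression:
  assumes V: "openin (top_of_set Sym) V" and \<Psi>: "C2_ext V \<psi> W \<Psi>" "w \<in> V" "w \<in> W"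
    and "a \<in> Sym" "b \<in> Sym" "z \<in> Sym" and inv: "invertible (\<Psi> w)"
  shows "local_metric \<psi> w b z + christoffel (local_metric \<psi>) w a a z =
    metric (\<Psi> w) (fder2 \<Psi> w a a + fder \<Psi> w b - fder \<Psi> w a ** matrix_inv (\<Psi> w) ** fder \<Psi> w a) (fder \<Psi> w z)"
proof -
  define Q where "Q = matrix_inv (\<Psi> w)"
  define X where "X = fder \<Psi> w a"
  define Z where "Z = fder \<Psi> w z"
  define Y where "Y = fder2 \<Psi> w a z"
  have sym: "fder2 \<Psi> w z a = Y"
    using fder2_symmetric[of W \<Psi> w] \<Psi> by (auto simp: C2_ext_def Y_def)
  have t1: "trace (Q ** Y ** Q ** X) = trace (Q ** X ** Q ** Y)"
    using trace_mul_sym[of "Q ** Y" "Q ** X"] by (simp add: matrix_mul_assoc)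
  have t2: "trace (Q ** Z ** Q ** X ** Q ** X) = trace (Q ** X ** Q ** X ** Q ** Z)"
    using trace_mul_sym[of "Q ** Z" "Q ** X ** Q ** X"] by (simp add: matrix_mul_assoc)
  have t3: "trace (Q ** X ** Q ** Z ** Q ** X) = trace (Q ** X ** Q ** X ** Q ** Z)"
    using trace_mul_sym[of "Q ** X ** Q ** Z" "Q ** X"] by (simp add: matrix_mul_assoc)
  note md = metric_deriv_local_metric[OF V \<Psi> _ _ _ inv, folded Q_def]
  have 1: "metric_deriv (local_metric \<psi>) w a a z =
      trace (Q ** fder2 \<Psi> w a a ** Q ** Z) + trace (Q ** X ** Q ** Y) - 2 * trace (Q ** X ** Q ** X ** Q ** Z)"
    using md[of a a z] assms by (simp add: sym flip: X_def Z_def)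
  have 2: "metric_deriv (local_metric \<psi>) w z a a =
      2 * trace (Q ** X ** Q ** Y) - 2 * trace (Q ** X ** Q ** X ** Q ** Z)"
    using md[of z a a] assms by (simp add: t1 t2 t3 flip: X_def Z_def Y_def)
  have 3: "local_metric \<psi> w b z = trace (Q ** fder \<Psi> w b ** Q ** Z)"
    using local_metric_eq[OF V \<Psi>, of b z] assms by (simp add: metric_def Q_def Z_def)
  \<comment> \<open>In Koszul's formula the traces containing \<open>Y\<close> cancel, and of the
    cubic traces exactly one remains with a minus sign; it is the X Q X correction.\<close>
  show ?thesis
    unfolding christoffel_def 1 2 3 metric_def X_def[symmetric] Z_def[symmetric] Q_def[symmetric]
    by (simp add: matrix_simps trace_add trace_sub matrix_mul_assoc)
qed

lemma openin_Sym_curve: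
  assumes "openin (top_of_set Sym) U" "open W" "(\<gamma> has_vector_derivative g) (at t within I)"
    "\<gamma> ` I \<subseteq> Sym" "\<gamma> t \<in> U" "\<gamma> t \<in> W"
  obtains T where "open T" "t \<in> T" "\<And>s. s \<in> I \<Longrightarrow> s \<in> T \<Longrightarrow> \<gamma> s \<in> U \<and> \<gamma> s \<in> W"
proof -
  obtain U0 where U0: "open U0" "U = Sym \<inter> U0"
    using assms(1) by (auto simp: openin_open)
  have "open (U0 \<inter> W)" "\<gamma> t \<in> U0 \<inter> W" using U0 assms by auto
  from has_vector_derivative_eventually_in[OF assms(3) this] obtain T where
    "open T" "t \<in> T" "\<And>s. s \<in> I \<Longrightarrow> s \<in> T \<Longrightarrow> \<gamma> s \<in> U0 \<inter> W" by blast
  with that[of T] U0 assms(4) show ?thesis by blast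
qed

text \<open>\<Phi> carries the jet of \<gamma> into coordinates, where it lies in L because the
  coordinate curve does. \<Psi> carries it back, and uniqueness of jets compares the result with the
  original one.\<close>

lemma chart_curve_jet:
  assumes chart: "slice_chart N U V \<phi> \<psi> L" and N: "N \<subseteq> SPD"
    and I: "is_interval I" "interior I \<noteq> {}"
    and \<gamma>: "\<gamma> ` I \<subseteq> N" "curve_jet I \<gamma> t g1 g2" "\<gamma> t \<in> U"
    and \<Psi>: "C2_ext V \<psi> W \<Psi>" "\<phi> (\<gamma> t) \<in> W" and \<Phi>: "C2_ext U \<phi> W' \<Phi>" "\<gamma> t \<in> W'"
  obtains c1 c2 where "curve_jet I (\<phi> \<circ> \<gamma>) t c1 c2" "c1 t = fder \<Phi> (\<gamma> t) (g1 t)"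
    "c1 t \<in> L" "c2 \<in> L" "g1 t = fder \<Psi> (\<phi> (\<gamma> t)) (c1 t)"
    "g2 = fder2 \<Psi> (\<phi> (\<gamma> t)) (c1 t) (c1 t) + fder \<Psi> (\<phi> (\<gamma> t)) c2"
proof -
  note ch = slice_chartD[OF chart]
  have t: "t \<in> I" using \<gamma>(2) by (simp add: curve_jet_def)
  have Sym: "\<gamma> ` I \<subseteq> Sym" using \<gamma>(1) N by (auto simp: SPD_def)
  have W': "open W'" "C2_on W' \<Phi>" "\<And>y. y \<in> U \<Longrightarrow> y \<in> W' \<Longrightarrow> \<Phi> y = \<phi> y"
    and W: "open W" "C2_on W \<Psi>" "\<And>y. y \<in> V \<Longrightarrow> y \<in> W \<Longrightarrow> \<Psi> y = \<psi> y"
    using \<Phi>(1) \<Psi>(1) by (auto simp: C2_ext_def)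
  obtain T where T: "open T" "t \<in> T" "\<And>s. s \<in> I \<Longrightarrow> s \<in> T \<Longrightarrow> \<gamma> s \<in> U \<and> \<gamma> s \<in> W'"
    using openin_Sym_curve[OF ch(2) W'(1) curve_jet_first[OF \<gamma>(2)] Sym \<gamma>(3) \<Phi>(2)] by blast
  let ?c1 = "\<lambda>s. fder \<Phi> (\<gamma> s) (g1 s)"
    and ?c2 = "fder2 \<Phi> (\<gamma> t) (g1 t) (g1 t) + fder \<Phi> (\<gamma> t) g2"
  have jet: "curve_jet I (\<phi> \<circ> \<gamma>) t ?c1 ?c2"
    by (rule curve_jet_transform[OF curve_jet_compose[OF \<gamma>(2) W'(2,1) \<Phi>(2)] T(1,2)])
       (use T(3) W'(3) in auto)
  have VL: "(\<phi> \<circ> \<gamma>) s \<in> V \<inter> L" if "s \<in> I" "s \<in> T" for s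
    using T(3)[OF that] \<gamma>(1) that ch(12) by auto
  have L: "?c1 t \<in> L" "?c2 \<in> L"
    using curve_jet_subspace[OF ch(10) jet I T(1,2)] VL by auto
  have cW: "(\<phi> \<circ> \<gamma>) t \<in> W" using \<Psi>(2) by simp
  obtain T' where T': "open T'" "t \<in> T'" "\<And>s. s \<in> I \<Longrightarrow> s \<in> T' \<Longrightarrow> (\<phi> \<circ> \<gamma>) s \<in> W"
    using has_vector_derivative_eventually_in[OF curve_jet_first[OF jet] W(1) cW] by blast
  have "\<Psi> ((\<phi> \<circ> \<gamma>) s) = \<gamma> s" if "s \<in> I" "s \<in> T \<inter> T'" for s
    using W(3) T'(3)[of s] VL[of s] T(3)[of s] ch(5) that by auto
  from curve_jet_transform[OF curve_jet_compose[OF jet W(2,1) cW] open_Int[OF T(1) T'(1)] _ this] T T'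
  have "curve_jet I \<gamma> t (\<lambda>s. fder \<Psi> ((\<phi> \<circ> \<gamma>) s) (?c1 s))
     (fder2 \<Psi> ((\<phi> \<circ> \<gamma>) t) (?c1 t) (?c1 t) + fder \<Psi> ((\<phi> \<circ> \<gamma>) t) ?c2)"
    by simp
  from curve_jet_unique[OF \<gamma>(2) this I] show ?thesis
    by (intro that[OF jet]) (use L in simp_all)
qed

definition geodesic_equation_at where
  "geodesic_equation_at \<phi> \<psi> L I \<gamma> t \<longleftrightarrow>
     (let h = local_metric \<psi>;
          c = \<phi> \<circ> \<gamma>;
          c' = (\<lambda>s. vector_derivative c (at s within I));
          c'' = (\<lambda>s. vector_derivative c' (at s within I))
      in \<forall>z\<in>L. h (c t) (c'' t) z + christoffel h (c t) (c' t) (c' t) z = 0)"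

lemma geodesic_alt:
  "geodesic N I \<gamma> \<longleftrightarrow>
     is_interval I \<and> interior I \<noteq> {} \<and> \<gamma> ` I \<subseteq> N \<and> smooth_on I \<gamma> \<and>
     (\<forall>U V \<phi> \<psi> L. slice_chart N U V \<phi> \<psi> L \<longrightarrow>
        (\<forall>t\<in>I. \<gamma> t \<in> U \<longrightarrow> geodesic_equation_at \<phi> \<psi> L I \<gamma> t))"
  unfolding geodesic_def geodesic_equation_at_def ..

lemma geodesic_equation_at_iff:
  assumes chart: "slice_chart N U V \<phi> \<psi> L" and N: "N \<subseteq> SPD"
    and I: "is_interval I" "interior I \<noteq> {}"
    and \<gamma>: "\<gamma> ` I \<subseteq> N" "curve_jet I \<gamma> t g1 g2" "\<gamma> t \<in> U"
    and \<Psi>: "C2_ext V \<psi> W \<Psi>" "\<phi> (\<gamma> t) \<in> W"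
  shows "geodesic_equation_at \<phi> \<psi> L I \<gamma> t \<longleftrightarrow>
    (\<forall>z\<in>L. metric (\<gamma> t) (g2 - g1 t ** matrix_inv (\<gamma> t) ** g1 t) (fder \<Psi> (\<phi> (\<gamma> t)) z) = 0)"
proof -
  note ch = slice_chartD[OF chart]
  obtain W' \<Phi> where \<Phi>: "C2_ext U \<phi> W' \<Phi>" "\<gamma> t \<in> W'"
    using smooth_on_C2_ext[OF ch(8) \<gamma>(3)] by blast
  obtain c1 c2 where c: "curve_jet I (\<phi> \<circ> \<gamma>) t c1 c2" "c1 t \<in> L" "c2 \<in> L"
    "g1 t = fder \<Psi> (\<phi> (\<gamma> t)) (c1 t)"
    "g2 = fder2 \<Psi> (\<phi> (\<gamma> t)) (c1 t) (c1 t) + fder \<Psi> (\<phi> (\<gamma> t)) c2"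
    using chart_curve_jet[OF chart N I \<gamma> \<Psi> \<Phi>] by blast
  have V: "\<phi> (\<gamma> t) \<in> V" using ch(4) \<gamma>(3) by blast
  then have p: "\<Psi> (\<phi> (\<gamma> t)) = \<gamma> t"
    using \<Psi> ch(5)[OF \<gamma>(3)] by (auto simp: C2_ext_def)
  have inv: "invertible (\<Psi> (\<phi> (\<gamma> t)))"
    unfolding p using \<gamma>(3) ch(1) SPD_invertible by blast
  note expr = local_geodesic_expression[OF ch(3) \<Psi>(1) V \<Psi>(2) _ _ _ inv, of "c1 t" c2, unfolded p, folded c(4,5)]
  show ?thesis
    unfolding geodesic_equation_at_def Let_def curve_jet_vector_derivative[OF c(1) I]
    using expr c(2,3) ch(11) by (auto simp: subset_iff)
qed


section \<open>Geodesics of a convex submanifold\<close>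

lemma smooth_on_id: "smooth_on S (\<lambda>x. x)"
  unfolding smooth_on_def using Ck_on_id by (intro ballI exI[of _ UNIV] exI[of _ "\<lambda>x. x"]) blast

lemma slice_chart_SPD_id: "slice_chart SPD SPD SPD (\<lambda>x. x) (\<lambda>x. x) Sym"
  using openin_SPD SPD_Sym
  by (auto simp: slice_chart_def homeomorphism_def smooth_on_id subspace_Sym)

text \<open>In the identity chart every symmetric matrix is a test vector, in particular the
  acceleration itself.\<close>

lemma SPD_geodesic_equation:
  assumes \<gamma>: "geodesic SPD I \<gamma>" and jet: "curve_jet I \<gamma> t g1 g2"
  shows "g2 = g1 t ** matrix_inv (\<gamma> t) ** g1 t"
proof -
  from \<gamma> have I: "is_interval I" "interior I \<noteq> {}" and im: "\<gamma> ` I \<subseteq> SPD"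
    by (auto simp: geodesic_alt)
  have t: "t \<in> I" using jet by (simp add: curve_jet_def)
  then have p: "\<gamma> t \<in> SPD" using im by blast
  have ext: "C2_ext SPD (\<lambda>x. x) UNIV (\<lambda>x::real^'a^'a. x)"
    unfolding C2_ext_def by (intro conjI Ck_on_id) auto
  define A where "A = g2 - g1 t ** matrix_inv (\<gamma> t) ** g1 t"
  have Sym: "g1 t \<in> Sym" "g2 \<in> Sym"
    using curve_jet_subspace[OF subspace_Sym jet I open_UNIV] im SPD_Sym by blast+
  have "transpose (matrix_inv (\<gamma> t)) = matrix_inv (\<gamma> t)"
    using matrix_inv_Sym[OF SPD_Sym[OF p] SPD_invertible[OF p]] by (simp add: Sym_def)
  then have A: "A \<in> Sym"
    using Sym by (simp add: A_def Sym_def transpose_linear_simps matrix_transpose_mul matrix_mul_assoc)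
  have "geodesic_equation_at (\<lambda>x. x) (\<lambda>x. x) Sym I \<gamma> t"
    using \<gamma> slice_chart_SPD_id t p unfolding geodesic_alt by blast
  then have "\<forall>z\<in>Sym. metric (\<gamma> t) A z = 0"
    using geodesic_equation_at_iff[OF slice_chart_SPD_id subset_refl I im jet p ext]
    by (simp add: A_def)
  with A metric_definite[OF p A] have "A = 0" by blast
  then show ?thesis by (simp add: A_def)
qed

text \<open>The equation says exactly that \<gamma>^(-1) \<gamma>' is constant, so \<gamma> solves a
  linear equation. Conjugation by the inverse square root of \<gamma>(0) moves the starting point to
  1.\<close>

lemma acceleration_free_curve:
  assumes I: "is_interval I" "interior I \<noteq> {}" "0 \<in> I"
    and im: "\<gamma> ` I \<subseteq> SPD" and sm: "smooth_on I \<gamma>"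
    and eq: "\<forall>t g1 g2. curve_jet I \<gamma> t g1 g2 \<longrightarrow> g2 = g1 t ** matrix_inv (\<gamma> t) ** g1 t"
    and x: "x \<in> SPD" "x ** x = \<gamma> 0"
  obtains C where "C \<in> Sym" "\<And>t. t \<in> I \<Longrightarrow> \<gamma> t = x ** mat_exp (t *\<^sub>R C) ** x"
proof -
  define g1 where "g1 s = vector_derivative \<gamma> (at s within I)" for s
  have jet: "\<exists>g2. curve_jet I \<gamma> t g1 g2" if "t \<in> I" for t
    using smooth_curve_jet[OF sm that] curve_jet_vector_derivative(3)[OF _ I(1,2)]
    unfolding g1_def by metis
  define K where "K t = matrix_inv (\<gamma> t) ** g1 t" for t
  have inv: "invertible (\<gamma> t)" if "t \<in> I" for t
    using im that SPD_invertible by blast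
  have g1: "(\<gamma> has_vector_derivative g1 t) (at t within I)" if "t \<in> I" for t
    using jet[OF that] curve_jet_first by blast
  have K: "(K has_vector_derivative 0) (at t within I)" if t: "t \<in> I" for t
  proof -
    obtain g2 where g2: "curve_jet I \<gamma> t g1 g2" using jet[OF t] by blast
    then have "(g1 has_vector_derivative g2) (at t within I)" by (simp add: curve_jet_def)
    from matrix_mult.has_vector_derivative[OF has_vector_derivative_matrix_inv[OF g1[OF t] inv[OF t]] this]
    show ?thesis
      unfolding K_def[abs_def] eq[rule_format, OF g2] by (simp add: matrix_simps matrix_mul_assoc)
  qed
  have Kconst: "K t = K 0" if "t \<in> I" for t
    using has_vector_derivative_zero_unique[OF is_interval_convex[OF I(1)] K that I(3)] .
  have g1K: "g1 t = \<gamma> t ** K 0" if "t \<in> I" for t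
    using Kconst[OF that] matrix_inv_right[OF inv[OF that]]
    by (metis K_def matrix_mul_assoc matrix_mul_lid)
  define y where "y = matrix_inv x"
  have xy: "x ** y = mat 1" "y ** x = mat 1"
    using matrix_inv[OF SPD_invertible[OF x(1)]] by (auto simp: y_def)
  have xy': "A ** x ** y = A" "A ** y ** x = A" for A :: "real^'a^'a"
    by (simp_all add: matrix_mul_assoc[symmetric] xy)
  have ysym: "transpose y = y"
    using matrix_inv_Sym[OF SPD_Sym[OF x(1)] SPD_invertible[OF x(1)]] by (simp add: y_def Sym_def)
  define C where "C = x ** K 0 ** y"
  define f where "f t = y ** \<gamma> t ** y" for t
  have "(f has_vector_derivative f t ** C) (at t within I)" if "t \<in> I" for t
  proof -
    have "(f has_vector_derivative y ** g1 t ** y) (at t within I)"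
      unfolding f_def[abs_def]
      by (rule bounded_linear.has_vector_derivative[OF matrix_mult.bounded_linear_left
            bounded_linear.has_vector_derivative[OF matrix_mult.bounded_linear_right g1[OF that]]])
    then show ?thesis
      by (simp add: g1K[OF that] f_def C_def matrix_mul_assoc xy')
  qed
  from mat_exp_ode_unique[OF is_interval_convex[OF I(1)] I(3) _ this]
  have f: "f t = f 0 ** mat_exp (t *\<^sub>R C)" if "t \<in> I" for t using that by blast
  have "f 0 = mat 1" by (simp add: f_def x(2)[symmetric] matrix_mul_assoc xy xy')
  have "\<gamma> t = x ** mat_exp (t *\<^sub>R C) ** x" if "t \<in> I" for t
  proof -
    have "\<gamma> t = x ** f t ** x" by (simp add: f_def matrix_mul_assoc xy xy')
    with f[OF that] \<open>f 0 = mat 1\<close> show ?thesis by simp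
  qed
  \<comment> \<open>C is also the conjugated initial velocity, which is visibly symmetric.\<close>
  moreover have "C \<in> Sym"
  proof -
    obtain g2 where g2: "curve_jet I \<gamma> 0 g1 g2" using jet[OF I(3)] by blast
    have "g1 0 \<in> Sym"
      using curve_jet_subspace[OF subspace_Sym g2 I(1,2) open_UNIV] im SPD_Sym by blast
    moreover have "C = y ** g1 0 ** y"
      by (simp add: C_def g1K[OF I(3)] x(2)[symmetric] matrix_mul_assoc xy)
    ultimately show ?thesis by (simp add: Sym_def matrix_transpose_mul ysym matrix_mul_assoc)
  qed
  ultimately show ?thesis using that by blast
qed

text \<open>The easy direction: a vanishing acceleration is orthogonal to every tangent vector of
  N.\<close>

lemma SPD_geodesic_imp_geodesic:
  assumes N: "N \<subseteq> SPD" and \<gamma>: "geodesic SPD I \<gamma>" and im: "\<gamma> ` I \<subseteq> N"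
  shows "geodesic N I \<gamma>"
  unfolding geodesic_alt
proof (intro conjI allI impI ballI)
  show I: "is_interval I" "interior I \<noteq> {}" and sm: "smooth_on I \<gamma>"
    using \<gamma> by (auto simp: geodesic_alt)
  show "\<gamma> ` I \<subseteq> N" by fact
  fix U V \<phi> \<psi> L t
  assume chart: "slice_chart N U V \<phi> \<psi> L" and t: "t \<in> I" "\<gamma> t \<in> U"
  obtain g1 g2 where jet: "curve_jet I \<gamma> t g1 g2" using smooth_curve_jet[OF sm t(1)] .
  note ch = slice_chartD[OF chart]
  obtain W \<Psi> where \<Psi>: "C2_ext V \<psi> W \<Psi>" "\<phi> (\<gamma> t) \<in> W"
    using smooth_on_C2_ext[OF ch(9) ch(4)[OF t(2)]] by blast
  show "geodesic_equation_at \<phi> \<psi> L I \<gamma> t"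
    unfolding geodesic_equation_at_iff[OF chart N I im jet t(2) \<Psi>]
    using SPD_geodesic_equation[OF \<gamma> jet] by (simp add: metric_def trace_0[unfolded mat_0])
qed

lemma convex_SPD_geodesic:
  assumes "N \<subseteq> SPD" "geodesically_convex N" "p \<in> N" "q \<in> N"
  obtains \<gamma> where "geodesic SPD {0..1} \<gamma>" "\<gamma> ` {0..1} \<subseteq> N" "\<gamma> 0 = p" "\<gamma> 1 = q"
  using assms unfolding geodesically_convex_def minimizing_geodesic_def by metis

text \<open>
  Vanishing of the second fundamental form: a tangent vector \<open>a\<close> is the limit of the rescaled
  initial velocities of the geodesics from \<open>p\<close> to \<open>\<psi> (w + s a)\<close> as \<open>s \<rightarrow> 0\<close>, which run inside \<open>N\<close>.
\<close>

lemma convex_imp_totally_geodesic: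
  fixes N :: "(real^'n^'n) set"
  assumes N: "N \<subseteq> SPD" and conv: "geodesically_convex N"
    and chart: "slice_chart N U V \<phi> \<psi> L" and p: "p \<in> N" "p \<in> U"
    and \<Psi>: "C2_ext V \<psi> W \<Psi>" "\<phi> p \<in> W" and a: "a \<in> L"
  shows "fder2 \<Psi> (\<phi> p) a a - fder \<Psi> (\<phi> p) a ** matrix_inv p ** fder \<Psi> (\<phi> p) a \<in> fder \<Psi> (\<phi> p) ` L"
proof -
  note ch = slice_chartD[OF chart]
  define w where "w = \<phi> p"
  have wV: "w \<in> V" "w \<in> W" using ch(4) p \<Psi> by (auto simp: w_def)
  have wL: "w \<in> L" using ch(12) p by (auto simp: w_def)
  have W: "open W" "C2_on W \<Psi>" "\<And>y. y \<in> V \<Longrightarrow> y \<in> W \<Longrightarrow> \<Psi> y = \<psi> y"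
    using \<Psi>(1) by (auto simp: C2_ext_def)
  have \<Psi>w: "\<Psi> w = p" using W(3) wV ch(5) p by (simp add: w_def)
  obtain W' \<Phi> where \<Phi>: "C2_ext U \<phi> W' \<Phi>" "p \<in> W'"
    using smooth_on_C2_ext[OF ch(8) p(2)] by blast
  have W': "open W'" "C2_on W' \<Phi>" "\<And>y. y \<in> U \<Longrightarrow> y \<in> W' \<Longrightarrow> \<Phi> y = \<phi> y"
    using \<Phi>(1) by (auto simp: C2_ext_def)
  note lin = linear_fder[OF W(2) wV(2)] and lin\<Phi> = linear_fder[OF W'(2) \<Phi>(2)]
  define Tg where "Tg = fder \<Psi> w ` L"
  have subTg: "subspace Tg"
    unfolding Tg_def by (rule linear_subspace_image[OF lin ch(10)])
  define S where "S v = fder2 \<Psi> w v v - fder \<Psi> w v ** matrix_inv p ** fder \<Psi> w v" for v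
  obtain x where x: "x \<in> SPD" "x ** x = p" using SPD_sqrt N p by blast
  define y where "y = matrix_inv x"
  have xy: "x ** y = mat 1" "y ** x = mat 1"
    using matrix_inv[OF SPD_invertible[OF x(1)]] by (auto simp: y_def)
  have xy': "A ** x ** y = A" "A ** y ** x = A" for A :: "real^'n^'n"
    by (simp_all add: matrix_mul_assoc[symmetric] xy)
  \<comment> \<open>Coordinate velocity at time 0 of the geodesic x exp(tC) x.\<close>
  define vel where "vel C = fder \<Phi> p (x ** C ** x)" for C
  \<comment> \<open>The conclusion is conditional so that C can be chosen for all s at once; C = 0
    serves where the line has left the chart.\<close>
  have "\<exists>C\<in>Sym. w + s *\<^sub>R a \<in> V \<and> w + s *\<^sub>R a \<in> W \<longrightarrow>
      x ** mat_exp C ** x = \<Psi> (w + s *\<^sub>R a) \<and> S (vel C) \<in> Tg" for s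
  proof (cases "w + s *\<^sub>R a \<in> V \<and> w + s *\<^sub>R a \<in> W")
    case True
    then have "w + s *\<^sub>R a \<in> V \<inter> L"
      using wL a ch(10) by (auto intro: subspace_add subspace_scale)
    then obtain q where q: "q \<in> N" "q \<in> U" "w + s *\<^sub>R a = \<phi> q"
      unfolding ch(12)[symmetric] by blast
    have \<Psi>q: "\<Psi> (w + s *\<^sub>R a) = q"
      using True W(3) q ch(5) by metis
    obtain \<gamma> where \<gamma>: "geodesic SPD {0..1} \<gamma>" "\<gamma> ` {0..1} \<subseteq> N" "\<gamma> 0 = p" "\<gamma> 1 = q"
      using convex_SPD_geodesic[OF N conv p(1) q(1)] .
    from \<gamma>(1) have I: "is_interval {0..1::real}" "interior {0..1::real} \<noteq> {}"
      and im: "\<gamma> ` {0..1} \<subseteq> SPD" and sm: "smooth_on {0..1} \<gamma>"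
      by (auto simp: geodesic_alt)
    have x\<gamma>: "x ** x = \<gamma> 0" using x \<gamma> by simp
    have 01: "0 \<in> {0..1::real}" by simp
    have eq: "\<forall>t g1 g2. curve_jet {0..1} \<gamma> t g1 g2 \<longrightarrow> g2 = g1 t ** matrix_inv (\<gamma> t) ** g1 t"
      using SPD_geodesic_equation[OF \<gamma>(1)] by blast
    obtain C where C: "C \<in> Sym" "\<And>t. t \<in> {0..1} \<Longrightarrow> \<gamma> t = x ** mat_exp (t *\<^sub>R C) ** x"
      using acceleration_free_curve[OF I 01 im sm eq x(1) x\<gamma>] by blast
    from smooth_curve_jet[OF sm 01] obtain g1 g2 where jet: "curve_jet {0..1} \<gamma> 0 g1 g2" .
    have "((\<lambda>t. x ** mat_exp (t *\<^sub>R C) ** x) has_vector_derivative x ** (mat_exp (0 *\<^sub>R C) ** C) ** x) (at 0 within {0..1})"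
      by (rule bounded_linear.has_vector_derivative[OF matrix_mult.bounded_linear_left
            bounded_linear.has_vector_derivative[OF matrix_mult.bounded_linear_right
            has_vector_derivative_mat_exp(2)]])
    then have "(\<gamma> has_vector_derivative x ** C ** x) (at 0 within {0..1})"
      by (rule has_vector_derivative_transform_open[OF _ open_UNIV, THEN has_vector_derivative_eq_rhs])
         (use C(2) in auto)
    then have g1: "g1 0 = x ** C ** x"
      using vector_derivative_unique_within[OF interval_at_within_not_bot[OF I] curve_jet_first[OF jet]] by simp
    have g2: "g2 = g1 0 ** matrix_inv p ** g1 0"
      using SPD_geodesic_equation[OF \<gamma>(1) jet] \<gamma>(3) by simp
    have cond: "\<gamma> 0 \<in> U" "\<phi> (\<gamma> 0) \<in> W" "\<gamma> 0 \<in> W'" using p \<Psi> \<Phi> \<gamma>(3) by auto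
    obtain c1 c2 where "curve_jet {0..1} (\<phi> \<circ> \<gamma>) 0 c1 c2" and c: "c1 0 = fder \<Phi> (\<gamma> 0) (g1 0)" "c1 0 \<in> L" "c2 \<in> L"
      "g1 0 = fder \<Psi> (\<phi> (\<gamma> 0)) (c1 0)"
      "g2 = fder2 \<Psi> (\<phi> (\<gamma> 0)) (c1 0) (c1 0) + fder \<Psi> (\<phi> (\<gamma> 0)) c2"
      by (rule chart_curve_jet[OF chart N I \<gamma>(2) jet cond(1) \<Psi>(1) cond(2) \<Phi>(1) cond(3)])
    have "vel C = c1 0" using c(1) \<gamma>(3) g1 by (simp add: vel_def)
    \<comment> \<open>Compare the two expressions for the acceleration g2: by the chain rule and by
      the geodesic equation of \<open>SPD\<close>. Their difference is tangent to N.\<close>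
    moreover have "S (c1 0) = - fder \<Psi> w c2"
      using c(4,5) g2 \<gamma>(3) by (simp add: S_def w_def algebra_simps)
    moreover have "- fder \<Psi> w c2 \<in> Tg"
      using c(3) subTg by (auto simp: Tg_def intro!: subspace_neg)
    ultimately show ?thesis
      using C(1) C(2)[of 1] \<gamma>(4) \<Psi>q by (intro bexI[of _ C]) auto
  qed (use subspace_0[OF subspace_Sym] in blast)
  then obtain C where C: "\<And>s. C s \<in> Sym"
    "\<And>s. w + s *\<^sub>R a \<in> V \<Longrightarrow> w + s *\<^sub>R a \<in> W \<Longrightarrow> x ** mat_exp (C s) ** x = \<Psi> (w + s *\<^sub>R a) \<and> S (vel (C s)) \<in> Tg"
    by metis
  have aS: "a \<in> Sym" using a ch(11) by blast
  obtain T where T: "open T" "(0::real) \<in> T" "\<And>t. t \<in> T \<Longrightarrow> w + t *\<^sub>R a \<in> V \<and> w + t *\<^sub>R a \<in> W"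
    using openin_line[OF ch(3) W(1) wV aS] by blast
  have evT: "\<forall>\<^sub>F s in at_right 0. s \<in> T"
    using T(1,2) by (simp add: eventually_at_topological) blast
  define X where "X = fder \<Psi> w a"
  have line: "((\<lambda>t. w + t *\<^sub>R a) has_vector_derivative a) (at 0 within S)" for S
    by (auto intro!: derivative_eq_intros)
  have w0: "w + 0 *\<^sub>R a \<in> W" using wV by simp
  note d\<Psi> = fder_curve[OF line W(2) w0]
  have \<Psi>slope: "((\<lambda>s. (\<Psi> (w + s *\<^sub>R a) - p) /\<^sub>R s) \<longlongrightarrow> X) (at_right 0)"
    using d\<Psi>[of "{0<..}"] unfolding has_vector_derivative_iff_slope by (simp add: \<Psi>w X_def)
  have expC: "mat_exp (C s) = y ** \<Psi> (w + s *\<^sub>R a) ** y" if "s \<in> T" for s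
    using C(2)[of s] T(3)[OF that] by (metis matrix_mul_assoc xy xy'(1) matrix_mul_lid)
  \<comment> \<open>The end points \<Psi> (w + s a) determine exp(C s), and its slope at 0 is passed
    to C s itself by the first-order inverse of the exponential.\<close>
  have slope: "((\<lambda>s. (mat_exp (C s) - mat 1) /\<^sub>R s) \<longlongrightarrow> y ** X ** y) (at_right 0)"
  proof (rule Lim_transform_eventually)
    show "((\<lambda>s. y ** ((\<Psi> (w + s *\<^sub>R a) - p) /\<^sub>R s) ** y) \<longlongrightarrow> y ** X ** y) (at_right 0)"
      by (intro matrix_mult.tendsto tendsto_const \<Psi>slope)
    have ypy: "y ** p ** y = mat 1" by (simp add: x(2)[symmetric] matrix_mul_assoc xy)
    show "\<forall>\<^sub>F s in at_right 0. y ** ((\<Psi> (w + s *\<^sub>R a) - p) /\<^sub>R s) ** y = (mat_exp (C s) - mat 1) /\<^sub>R s"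
      using evT by eventually_elim (simp add: expC matrix_simps ypy)
  qed
  have "((\<lambda>s. s *\<^sub>R ((mat_exp (C s) - mat 1) /\<^sub>R s)) \<longlongrightarrow> 0 *\<^sub>R (y ** X ** y)) (at_right 0)"
    by (intro tendsto_scaleR tendsto_ident_at slope)
  then have "((\<lambda>s. mat_exp (C s) - mat 1) \<longlongrightarrow> 0) (at_right 0)"
    unfolding scaleR_zero_left
    by (rule Lim_transform_eventually) (auto simp: eventually_at_right_field intro!: exI[of _ 1])
  then have "((\<lambda>s. mat_exp (C s)) \<longlongrightarrow> mat 1) (at_right 0)"
    by (rule LIM_zero_cancel)
  then have "(C \<longlongrightarrow> 0) (at_right 0)"
    by (rule tendsto_zero_if_mat_exp_tendsto_one[OF C(1)])
  then have Cslope: "((\<lambda>s. C s /\<^sub>R s) \<longlongrightarrow> y ** X ** y) (at_right 0)"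
    by (rule mat_exp_first_order_inverse[OF _ slope])
  \<comment> \<open>\<Phi> inverts \<Psi> along the line, so its derivative sends the tangent vector
    X back to the coordinate direction a.\<close>
  have \<Phi>X: "fder \<Phi> p X = a"
  proof -
    have d: "((\<lambda>t. \<Psi> (w + t *\<^sub>R a)) has_vector_derivative X) (at 0 within UNIV)"
      using d\<Psi>[of UNIV] by (simp add: X_def)
    have 0: "\<Psi> (w + 0 *\<^sub>R a) \<in> W'" using \<Phi>(2) \<Psi>w by simp
    obtain T' where T': "open T'" "0 \<in> T'" "\<And>s. s \<in> UNIV \<Longrightarrow> s \<in> T' \<Longrightarrow> \<Psi> (w + s *\<^sub>R a) \<in> W'"
      by (rule has_vector_derivative_eventually_in[OF d W'(1) 0], rule that) blast+
    have "\<Phi> (\<Psi> (w + s *\<^sub>R a)) = w + s *\<^sub>R a" if "s \<in> T \<inter> T'" for s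
    proof -
      have v: "w + s *\<^sub>R a \<in> V" "w + s *\<^sub>R a \<in> W" "\<Psi> (w + s *\<^sub>R a) \<in> W'"
        using T(3)[of s] T'(3)[of s] that by auto
      then show ?thesis
        using W'(3)[of "\<psi> (w + s *\<^sub>R a)"] ch(6,7)[OF v(1)] W(3)[OF v(1,2)] by simp
    qed
    from has_vector_derivative_transform_open[OF fder_curve[OF d W'(2) 0] open_Int[OF T(1) T'(1)] _ _ this]
    have "((\<lambda>s. w + s *\<^sub>R a) has_vector_derivative fder \<Phi> p X) (at 0 within UNIV)"
      using T(2) T'(2) by (simp add: \<Psi>w)
    with line[of UNIV] show ?thesis
      by (simp add: vector_derivative_unique_at)
  qed
  have blin\<Phi>: "bounded_linear (fder \<Phi> p)" using lin\<Phi> by (simp add: linear_conv_bounded_linear)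
  have velslope: "((\<lambda>s. vel (C s) /\<^sub>R s) \<longlongrightarrow> a) (at_right 0)"
  proof -
    have "((\<lambda>s. fder \<Phi> p (x ** (C s /\<^sub>R s) ** x)) \<longlongrightarrow> fder \<Phi> p (x ** (y ** X ** y) ** x)) (at_right 0)"
      by (intro bounded_linear.tendsto[OF blin\<Phi>] matrix_mult.tendsto tendsto_const Cslope)
    moreover have "x ** (y ** X ** y) ** x = X" by (simp add: matrix_mul_assoc xy xy')
    moreover have "fder \<Phi> p (x ** (C s /\<^sub>R s) ** x) = vel (C s) /\<^sub>R s" for s
      by (simp add: vel_def matrix_simps linear_cmul[OF lin\<Phi>])
    ultimately show ?thesis by (simp add: \<Phi>X)
  qed
  have "bilinear (fder2 \<Psi> w)"
    using linear_fder2[OF W(2) wV(2)] fder2_symmetric[OF W(2,1) wV(2)]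
    unfolding bilinear_def by (metis (no_types, lifting) ext)
  then have bil: "bounded_bilinear (fder2 \<Psi> w)" by (simp add: bilinear_conv_bounded_bilinear)
  have blin: "bounded_linear (fder \<Psi> w)" using lin by (simp add: linear_conv_bounded_linear)
  \<comment> \<open>S is homogeneous of degree 2, so rescaling the velocity keeps its value in the
    subspace Tg, which is closed and therefore contains the limit S a.\<close>
  have "((\<lambda>s. S (vel (C s) /\<^sub>R s)) \<longlongrightarrow> S a) (at_right 0)"
    unfolding S_def
    by (intro tendsto_diff bounded_bilinear.tendsto[OF bil] bounded_linear.tendsto[OF blin]
        matrix_mult.tendsto tendsto_const velslope)
  moreover have "\<forall>\<^sub>F s in at_right 0. S (vel (C s) /\<^sub>R s) \<in> Tg"
    using evT
  proof eventually_elim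
    case (elim s)
    have "S (r *\<^sub>R v) = r\<^sup>2 *\<^sub>R S v" for r v
      unfolding S_def linear_cmul[OF lin] bounded_bilinear.scaleR_left[OF bil]
        bounded_bilinear.scaleR_right[OF bil] matrix_simps
      by (simp add: scaleR_diff_right power2_eq_square)
    then show ?case
      using C(2) T(3)[OF elim] subTg by (auto intro: subspace_scale)
  qed
  ultimately have "S a \<in> Tg"
    by (intro Lim_in_closed_set[OF closed_subspace[OF subTg]]) auto
  then show ?thesis by (simp add: S_def Tg_def w_def)
qed

text \<open>The covariant acceleration is tangent to N because N is totally geodesic, and orthogonal
  to the tangent space by the geodesic equation. Hence it is orthogonal to itself.\<close>

lemma geodesic_acceleration_free:
  assumes N: "N \<subseteq> SPD" and conv: "geodesically_convex N"
    and chart: "slice_chart N U V \<phi> \<psi> L" and \<gamma>: "geodesic N I \<gamma>" "curve_jet I \<gamma> t g1 g2" "\<gamma> t \<in> U"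
  shows "g2 = g1 t ** matrix_inv (\<gamma> t) ** g1 t"
proof -
  note ch = slice_chartD[OF chart]
  from \<gamma>(1) have I: "is_interval I" "interior I \<noteq> {}" and im: "\<gamma> ` I \<subseteq> N"
    by (auto simp: geodesic_alt)
  have t: "t \<in> I" using \<gamma>(2) by (simp add: curve_jet_def)
  have p: "\<gamma> t \<in> N" using im t by blast
  obtain W \<Psi> where \<Psi>: "C2_ext V \<psi> W \<Psi>" "\<phi> (\<gamma> t) \<in> W"
    using smooth_on_C2_ext[OF ch(9) ch(4)[OF \<gamma>(3)]] by blast
  obtain W' \<Phi> where \<Phi>: "C2_ext U \<phi> W' \<Phi>" "\<gamma> t \<in> W'"
    using smooth_on_C2_ext[OF ch(8) \<gamma>(3)] by blast
  obtain c1 c2 where "curve_jet I (\<phi> \<circ> \<gamma>) t c1 c2" "c1 t = fder \<Phi> (\<gamma> t) (g1 t)"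
    and c: "c1 t \<in> L" "c2 \<in> L" "g1 t = fder \<Psi> (\<phi> (\<gamma> t)) (c1 t)"
    "g2 = fder2 \<Psi> (\<phi> (\<gamma> t)) (c1 t) (c1 t) + fder \<Psi> (\<phi> (\<gamma> t)) c2"
    by (rule chart_curve_jet[OF chart N I im \<gamma>(2,3) \<Psi> \<Phi>])
  have "C2_on W \<Psi>" using \<Psi> by (simp add: C2_ext_def)
  note lin = linear_fder[OF this \<Psi>(2)]
  obtain l where l: "l \<in> L" "fder2 \<Psi> (\<phi> (\<gamma> t)) (c1 t) (c1 t) - g1 t ** matrix_inv (\<gamma> t) ** g1 t = fder \<Psi> (\<phi> (\<gamma> t)) l"
    using convex_imp_totally_geodesic[OF N conv chart p \<gamma>(3) \<Psi> c(1)] unfolding c(3) by blast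
  define A where "A = g2 - g1 t ** matrix_inv (\<gamma> t) ** g1 t"
  have A: "A = fder \<Psi> (\<phi> (\<gamma> t)) (l + c2)"
    using l(2) unfolding A_def c(4) linear_add[OF lin] by (simp add: algebra_simps)
  have "geodesic_equation_at \<phi> \<psi> L I \<gamma> t"
    using \<gamma>(1,3) chart t unfolding geodesic_alt by blast
  then have "metric (\<gamma> t) A A = 0"
    unfolding geodesic_equation_at_iff[OF chart N I im \<gamma>(2,3) \<Psi>]
    using A l(1) c(2) ch(10) by (auto simp: A_def intro: subspace_add)
  moreover have pS: "\<gamma> t \<in> SPD" using p N by blast
  moreover have "A \<in> Sym"
  proof -
    have "transpose (matrix_inv (\<gamma> t)) = matrix_inv (\<gamma> t)"
      using matrix_inv_Sym[OF SPD_Sym[OF pS] SPD_invertible[OF pS]] by (simp add: Sym_def)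
    moreover have "g1 t \<in> Sym" "g2 \<in> Sym"
      using curve_jet_subspace[OF subspace_Sym \<gamma>(2) I open_UNIV] im N SPD_Sym by blast+
    ultimately show ?thesis
      by (simp add: A_def Sym_def transpose_linear_simps matrix_transpose_mul matrix_mul_assoc)
  qed
  ultimately have "A = 0" using metric_definite by blast
  then show ?thesis by (simp add: A_def)
qed

text \<open>The convexity segment is a geodesic of N, completeness extends it within N, and the
  extension has zero acceleration in \<open>SPD\<close>, hence is one exponential curve.\<close>

lemma full_geodesic_between:
  assumes sub: "submanifold N" and conv: "geodesically_convex N" and compl: "geodesically_complete N"
    and x: "x \<in> SPD" "x ** x \<in> N" and q: "q \<in> N"
  obtains C where "C \<in> Sym" "\<And>t. x ** mat_exp (t *\<^sub>R C) ** x \<in> N" "x ** mat_exp C ** x = q"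
proof -
  have N: "N \<subseteq> SPD" using sub by (simp add: submanifold_def)
  obtain \<gamma> where \<gamma>: "geodesic SPD {0..1} \<gamma>" "\<gamma> ` {0..1} \<subseteq> N" "\<gamma> 0 = x ** x" "\<gamma> 1 = q"
    using convex_SPD_geodesic[OF N conv x(2) q] .
  obtain \<beta> where \<beta>: "geodesic N UNIV \<beta>" "\<forall>t\<in>{0..1}. \<beta> t = \<gamma> t"
    using compl SPD_geodesic_imp_geodesic[OF N \<gamma>(1,2)] unfolding geodesically_complete_def by blast
  from \<beta>(1) have I: "is_interval (UNIV::real set)" "interior (UNIV::real set) \<noteq> {}"
    and im: "\<beta> ` UNIV \<subseteq> N" and sm: "smooth_on UNIV \<beta>"
    by (auto simp: geodesic_alt)
  have eq: "g2 = g1 t ** matrix_inv (\<beta> t) ** g1 t" if jet: "curve_jet UNIV \<beta> t g1 g2" for t g1 g2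
  proof -
    obtain U V \<phi> \<psi> L where chart: "slice_chart N U V \<phi> \<psi> L" "\<beta> t \<in> U"
      using sub im unfolding submanifold_def by blast
    then show ?thesis
      using geodesic_acceleration_free[OF N conv chart(1) \<beta>(1) jet chart(2)] by blast
  qed
  then have eq': "\<forall>t g1 g2. curve_jet UNIV \<beta> t g1 g2 \<longrightarrow> g2 = g1 t ** matrix_inv (\<beta> t) ** g1 t"
    by blast
  have im': "\<beta> ` UNIV \<subseteq> SPD" using im N by blast
  have x\<beta>: "x ** x = \<beta> 0" using \<beta>(2) \<gamma>(3) by simp
  obtain C where C: "C \<in> Sym" "\<And>t. \<beta> t = x ** mat_exp (t *\<^sub>R C) ** x"
    using acceleration_free_curve[OF I UNIV_I im' sm eq' x(1) x\<beta>] by (metis UNIV_I)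
  have "x ** mat_exp C ** x = q" using C(2)[of 1] \<beta>(2) \<gamma>(4) by simp
  moreover have "x ** mat_exp (t *\<^sub>R C) ** x \<in> N" for t unfolding C(2)[of t, symmetric] using im by blast
  ultimately show ?thesis using that[OF C(1)] by blast
qed


section \<open>The Lie triple system\<close>

lemma continuous_on_mat_exp: "continuous_on UNIV (mat_exp :: real^'n^'n \<Rightarrow> real^'n^'n)"
proof -
  obtain K where K: "K > 0" "\<And>(A :: real^'n^'n) (B :: real^'n^'n). norm (A ** B) \<le> norm A * norm B * K"
    using matrix_mult_norm_bound by blast
  have cont: "continuous_on S (\<lambda>A :: real^'n^'n. mat_power A k)" for S k
    by (induction k) (auto intro!: matrix_mult.continuous_on continuous_intros)
  have *: "continuous_on (ball 0 r) (mat_exp :: real^'n^'n \<Rightarrow> real^'n^'n)" for r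
  proof (rule uniform_limit_theorem)
    show "uniform_limit (ball 0 r) (\<lambda>m A :: real^'n^'n. \<Sum>k<m. (1 / fact k) *\<^sub>R mat_power A k) mat_exp sequentially"
      unfolding mat_exp_def
    proof (rule Weierstrass_m_test)
      fix k and A :: "real^'n^'n" assume "A \<in> ball 0 r"
      then have A: "norm A \<le> \<bar>r\<bar>" by simp
      have "norm ((1 / fact k) *\<^sub>R mat_power A k) \<le> norm (mat 1 :: real^'n^'n) * ((K * norm A) ^ k /\<^sub>R fact k)"
        by (rule mat_exp_term_bound[OF K])
      also have "\<dots> \<le> norm (mat 1 :: real^'n^'n) * ((K * \<bar>r\<bar>) ^ k /\<^sub>R fact k)"
        using K(1) A by (intro mult_left_mono scaleR_left_mono power_mono) auto
      finally show "norm ((1 / fact k) *\<^sub>R mat_power A k) \<le> norm (mat 1 :: real^'n^'n) * ((K * \<bar>r\<bar>) ^ k /\<^sub>R fact k)" .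
    qed (rule summable_mult[OF summable_exp_real])
    show "\<forall>\<^sub>F m in sequentially. continuous_on (ball 0 r) (\<lambda>A :: real^'n^'n. \<Sum>k<m. (1 / fact k) *\<^sub>R mat_power A k)"
      by (intro always_eventually allI continuous_intros cont)
  qed simp
  have "isCont mat_exp A" for A :: "real^'n^'n"
    using *[of "norm A + 1"] by (simp add: continuous_on_eq_continuous_at)
  then show ?thesis by (simp add: continuous_on_eq_continuous_at)
qed

lemma expands2_tendsto:
  assumes "expands2 f a0 a1 a2"
  shows "(f \<longlongrightarrow> a0) (at_right 0)"
proof -
  have "expands2 (\<lambda>s. f s - a0) 0 a1 a2"
    using assms by (simp add: expands2_def)
  from expands2_first_order(2)[OF this] show ?thesis by (rule LIM_zero_cancel)
qed

lemma expands2_eq_rhs: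
  "expands2 f a0 a1 a2 \<Longrightarrow> a0 = b0 \<Longrightarrow> a1 = b1 \<Longrightarrow> a2 = b2 \<Longrightarrow> expands2 f b0 b1 b2"
  by simp

section \<open>Geodesic symmetries and their infinitesimal form\<close>

locale geodesic_set =
  fixes N :: "(real^'n^'n) set" and x y :: "real^'n^'n"
  assumes sub: "submanifold N" and conv: "geodesically_convex N" and compl: "geodesically_complete N"
    and x: "x \<in> SPD" "x ** x \<in> N" and y_def: "y = matrix_inv x"
begin

definition M where "M = {Q. x ** Q ** x \<in> N}"

definition E where "E = {X \<in> Sym. \<forall>t. mat_exp (t *\<^sub>R X) \<in> M}"

lemma xy: "x ** y = mat 1" "y ** x = mat 1"
  "A ** x ** y = A" "A ** y ** x = A"
  using matrix_inv[OF SPD_invertible[OF x(1)]] by (simp_all add: y_def matrix_mul_assoc[symmetric])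

lemma one_in_M: "mat 1 \<in> M"
  using x by (simp add: M_def)

text \<open>The symmetry at P reverses geodesics through P. With the square root z of x P x as base,
  Q lies at time 1 of a full geodesic, and its reflection is the point at time -1.\<close>

lemma M_reflect:
  assumes P: "P \<in> M" and Q: "Q \<in> M"
  shows "P ** matrix_inv Q ** P \<in> M"
proof -
  have "x ** P ** x \<in> SPD" using P sub by (auto simp: M_def submanifold_def)
  then obtain z where z: "z \<in> SPD" "z ** z = x ** P ** x" using SPD_sqrt by blast
  define z' where "z' = matrix_inv z"
  have zz': "z ** z' = mat 1" "z' ** z = mat 1" "A ** z ** z' = A" "A ** z' ** z = A" for A :: "real^'n^'n"
    using matrix_inv[OF SPD_invertible[OF z(1)]] by (simp_all add: z'_def matrix_mul_assoc[symmetric])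
  have "z ** z \<in> N" "x ** Q ** x \<in> N" using P Q z by (simp_all add: M_def)
  from full_geodesic_between[OF sub conv compl z(1) this]
  obtain C where C: "\<And>t. z ** mat_exp (t *\<^sub>R C) ** z \<in> N" "z ** mat_exp C ** z = x ** Q ** x"
    by metis
  have P': "P = y ** (z ** z) ** y" unfolding z(2) by (simp add: matrix_mul_assoc xy)
  have "Q = y ** (x ** Q ** x) ** y" by (simp add: matrix_mul_assoc xy)
  then have Q': "Q = y ** z ** mat_exp C ** z ** y" unfolding C(2)[symmetric] by (simp add: matrix_mul_assoc)
  have ee: "A ** mat_exp C ** mat_exp (- C) = A" for A
    by (simp add: matrix_mul_assoc[symmetric] mat_exp_minus)
  have "Q ** (x ** z' ** mat_exp (- C) ** z' ** x) = mat 1"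
    unfolding Q' by (simp add: matrix_mul_assoc xy zz' ee)
  then have "matrix_inv Q = x ** z' ** mat_exp (- C) ** z' ** x"
    by (rule matrix_inv_unique)
  then have "x ** (P ** matrix_inv Q ** P) ** x = z ** mat_exp (- C) ** z"
    unfolding P' by (simp add: matrix_mul_assoc xy zz')
  then show ?thesis using C(1)[of "- 1"] by (simp add: M_def)
qed

lemma M_eq_exp_E:
  assumes "Q \<in> M"
  obtains u where "u \<in> E" "mat_exp u = Q"
proof -
  have "x ** Q ** x \<in> N" using assms by (simp add: M_def)
  then obtain C where C: "C \<in> Sym" "\<And>t. x ** mat_exp (t *\<^sub>R C) ** x \<in> N" "x ** mat_exp C ** x = x ** Q ** x"
    using full_geodesic_between[OF sub conv compl x] by metis
  have "y ** (x ** mat_exp C ** x) ** y = y ** (x ** Q ** x) ** y" by (simp add: C(3))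
  then have "mat_exp C = Q" by (simp add: matrix_mul_assoc xy)
  with C that show ?thesis by (auto simp: E_def M_def)
qed

lemma E_Sym: "X \<in> E \<Longrightarrow> X \<in> Sym" and E_exp: "X \<in> E \<Longrightarrow> mat_exp (t *\<^sub>R X) \<in> M"
  by (auto simp: E_def)

text \<open>The inverse of Q = exp(u) lies in \<open>M\<close> on the same line; reflecting that
  inverse in P gives P Q P.\<close>

lemma M_conj:
  assumes "P \<in> M" "Q \<in> M"
  shows "P ** Q ** P \<in> M"
proof -
  obtain u where u: "u \<in> E" "mat_exp u = Q" using M_eq_exp_E[OF assms(2)] .
  have "mat_exp (- u) \<in> M" using E_exp[OF u(1), of "- 1"] by simp
  from M_reflect[OF assms(1) this] show ?thesis
    by (simp add: matrix_inv_mat_exp u)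
qed

lemma E_scale: "X \<in> E \<Longrightarrow> c *\<^sub>R X \<in> E"
  using subspace_scale[OF subspace_Sym] by (auto simp: E_def)

text \<open>Since exp(tX) is the palindrome exp(tX/2) 1 exp(tX/2), membership for small times
  doubles its range at each step.\<close>

lemma E_if_small:
  assumes X: "X \<in> Sym" and d: "d > 0" "\<And>t. \<bar>t\<bar> < d \<Longrightarrow> mat_exp (t *\<^sub>R X) \<in> M"
  shows "X \<in> E"
proof -
  have "mat_exp (t *\<^sub>R X) \<in> M" if "\<bar>t\<bar> < 2 ^ n * d" for n t
    using that
  proof (induction n arbitrary: t)
    case (Suc n)
    then have "mat_exp ((t / 2) *\<^sub>R X) \<in> M" by (intro Suc) simp
    from M_conj[OF this one_in_M] show ?case
      using mat_exp_add_scaleR[of "t / 2" "t / 2" X] by simp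
  qed (use d in simp)
  moreover have "\<exists>n. \<bar>t\<bar> < 2 ^ n * d" for t
    using real_arch_pow[of 2 "\<bar>t\<bar> / d"] d(1) by (auto simp: field_simps)
  ultimately have "mat_exp (t *\<^sub>R X) \<in> M" for t by metis
  then show ?thesis using X by (simp add: E_def)
qed

text \<open>Closedness only needs that \<open>N\<close> is closed in the domain of a slice chart at \<open>x ** x\<close>.\<close>

lemma closed_E: "closed E"
  unfolding closed_sequential_limits
proof (intro allI impI)
  fix X l assume "(\<forall>n. X n \<in> E) \<and> X \<longlonglongrightarrow> l"
  then have X: "\<And>n. X n \<in> E" "X \<longlonglongrightarrow> l" by auto
  have l: "l \<in> Sym"
    using closed_sequentially[OF closed_subspace[OF subspace_Sym]] X E_Sym by blast
  obtain U V \<phi> \<psi> L where chart: "slice_chart N U V \<phi> \<psi> L" "x ** x \<in> U"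
    using sub x unfolding submanifold_def by blast
  note ch = slice_chartD[OF chart(1)]
  have cont\<phi>: "continuous_on U \<phi>"
    using chart(1) by (auto simp: slice_chart_def homeomorphism_def)
  obtain U0 where U0: "open U0" "U = Sym \<inter> U0"
    using ch(2) by (auto simp: openin_open)
  define c where "c Y = x ** mat_exp Y ** x" for Y
  have cont: "continuous_on UNIV c"
    unfolding c_def[abs_def]
    by (intro matrix_mult.continuous_on continuous_on_const continuous_on_mat_exp)
  have cSym: "c Y \<in> Sym" if "Y \<in> Sym" for Y
    using mat_exp_Sym[OF that] SPD_Sym[OF x(1)]
    by (simp add: c_def Sym_def matrix_transpose_mul matrix_mul_assoc)
  \<comment> \<open>For small t the limit curve stays in the domain of the chart at its starting
    point; longer times follow by doubling.\<close>
  have "open ((\<lambda>t. c (t *\<^sub>R l)) -` U0)"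
    using U0(1) by (intro open_vimage continuous_on_compose2[OF cont] continuous_intros) auto
  moreover have "0 \<in> (\<lambda>t. c (t *\<^sub>R l)) -` U0"
    using chart(2) U0 by (simp add: c_def)
  ultimately obtain d where d: "d > 0" "ball 0 d \<subseteq> (\<lambda>t. c (t *\<^sub>R l)) -` U0"
    using open_contains_ball by blast
  have "mat_exp (t *\<^sub>R l) \<in> M" if "\<bar>t\<bar> < d" for t
  proof -
    have q: "c (t *\<^sub>R l) \<in> U"
      using d(2) that cSym[OF subspace_scale[OF subspace_Sym l]] U0 by auto
    have "(\<lambda>n. t *\<^sub>R X n) \<longlonglongrightarrow> t *\<^sub>R l" by (intro tendsto_intros X)
    moreover have "isCont c (t *\<^sub>R l)"
      using cont by (simp add: continuous_on_eq_continuous_at)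
    ultimately have lim: "(\<lambda>n. c (t *\<^sub>R X n)) \<longlonglongrightarrow> c (t *\<^sub>R l)"
      by (rule isCont_tendsto_compose[rotated])
    then have "\<forall>\<^sub>F n in sequentially. c (t *\<^sub>R X n) \<in> U0"
      using U0 q by (auto dest: topological_tendstoD)
    then have ev: "\<forall>\<^sub>F n in sequentially. c (t *\<^sub>R X n) \<in> U"
      using cSym[OF subspace_scale[OF subspace_Sym E_Sym[OF X(1)]]] U0 by auto
    have "(\<lambda>n. \<phi> (c (t *\<^sub>R X n))) \<longlonglongrightarrow> \<phi> (c (t *\<^sub>R l))"
      by (rule continuous_on_tendsto_compose[OF cont\<phi> lim q ev])
    moreover have "\<forall>\<^sub>F n in sequentially. \<phi> (c (t *\<^sub>R X n)) \<in> L"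
      using ev
    proof eventually_elim
      case (elim n)
      have "c (t *\<^sub>R X n) \<in> N" using E_exp[OF X(1)] by (simp add: M_def c_def)
      with elim ch(12) show ?case by blast
    qed
    \<comment> \<open>In the chart N is the closed linear piece L, so the limit stays in it.\<close>
    ultimately have "\<phi> (c (t *\<^sub>R l)) \<in> L"
      by (intro Lim_in_closed_set[OF closed_subspace[OF ch(10)]]) auto
    then have "\<phi> (c (t *\<^sub>R l)) \<in> \<phi> ` (N \<inter> U)" using ch(4)[OF q] ch(12) by blast
    then obtain r where r: "\<phi> (c (t *\<^sub>R l)) = \<phi> r" "r \<in> N \<inter> U" by (rule imageE)
    have "c (t *\<^sub>R l) = \<psi> (\<phi> r)" by (rule ch(5)[OF q, unfolded r(1), symmetric])
    also have "\<dots> = r" by (rule ch(5)) (rule IntD2[OF r(2)])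
    finally have "c (t *\<^sub>R l) = r" .
    then have "c (t *\<^sub>R l) \<in> N" using r(2) by simp
    then show ?thesis by (simp add: M_def c_def)
  qed
  then show "l \<in> E" by (rule E_if_small[OF l d(1)])
qed

text \<open>The second-order coefficient of the product is half the square of the first-order one,
  as for a pure exponential, so Z has no term in s^2. The middle factor carries 2Y to make the
  product equal to g g^T with g = exp(sX) exp(sY).\<close>

lemma palindrome_expansion:
  assumes "X \<in> E" "Y \<in> E"
  obtains Z where "\<And>s. Z s \<in> E"
    "\<And>s. mat_exp (Z s) = mat_exp (s *\<^sub>R X) ** mat_exp (s *\<^sub>R 2 *\<^sub>R Y) ** mat_exp (s *\<^sub>R X)"
    "expands2 Z 0 (2 *\<^sub>R (X + Y)) 0"
proof -
  define F where "F s = mat_exp (s *\<^sub>R X) ** mat_exp (s *\<^sub>R 2 *\<^sub>R Y) ** mat_exp (s *\<^sub>R X)" for s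
  have "F s \<in> M" for s
    unfolding F_def using assms by (intro M_conj E_exp E_scale)
  then have "\<exists>u\<in>E. mat_exp u = F s" for s using M_eq_exp_E by metis
  then obtain Z where Z: "\<And>s. Z s \<in> E" "\<And>s. mat_exp (Z s) = F s" by metis
  let ?W = "2 *\<^sub>R (X + Y)"
  note rays = expands2_mult[OF expands2_mult[OF expands2_exp_ray expands2_exp_ray] expands2_exp_ray]
  have F: "expands2 F (mat 1) ?W ((1/2) *\<^sub>R (?W ** ?W))"
    unfolding F_def[abs_def]
    by (rule expands2_eq_rhs[OF rays]) (simp_all add: matrix_simps, simp_all add: vec_eq_iff)
  have "(Z \<longlongrightarrow> 0) (at_right 0)"
    by (rule tendsto_zero_if_mat_exp_tendsto_one) (use Z E_Sym expands2_tendsto[OF F] in auto)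
  moreover have "(\<lambda>s. mat_exp (Z s)) = F" by (rule ext) (rule Z(2))
  ultimately have "expands2 Z 0 ?W 0" using expands2_mat_exp_inverse[of Z] F by force
  with Z that show ?thesis by (auto simp: F_def)
qed

text \<open>For sums: \<open>Z s / s\<close> stays in the closed set \<open>E\<close> and tends to 2
  (X + Y).\<close>

lemma subspace_E: "subspace E"
proof (rule subspaceI)
  show "0 \<in> E" using one_in_M by (simp add: E_def subspace_0[OF subspace_Sym])
  show "\<And>c X. X \<in> E \<Longrightarrow> c *\<^sub>R X \<in> E" by (rule E_scale)
  fix X Y assume "X \<in> E" "Y \<in> E"
  then obtain Z where Z: "\<And>s. Z s \<in> E" "expands2 Z 0 (2 *\<^sub>R (X + Y)) 0"
    using palindrome_expansion by metis
  have "2 *\<^sub>R (X + Y) \<in> E"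
    by (rule Lim_in_closed_set[OF closed_E _ _ expands2_first_order(1)[OF Z(2)]])
       (use Z(1) E_scale in auto)
  from E_scale[OF this, of "1/2"] show "X + Y \<in> E" by simp
qed

text \<open>
  The matrix \<open>k = exp(-Z/2) exp(sX) exp(sY)\<close> is orthogonal, conjugation by it preserves \<open>E\<close>, and
  \<open>k = 1 + s\<^sup>2 [X,Y] / 2 + o(s\<^sup>2)\<close>.
\<close>

lemma lie_triple:
  assumes X: "X \<in> E" and Y: "Y \<in> E" and B: "B \<in> E"
  shows "commutator (commutator X Y) B \<in> E"
proof -
  obtain Z where Z: "\<And>s. Z s \<in> E"
    "\<And>s. mat_exp (Z s) = mat_exp (s *\<^sub>R X) ** mat_exp (s *\<^sub>R 2 *\<^sub>R Y) ** mat_exp (s *\<^sub>R X)"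
    "expands2 Z 0 (2 *\<^sub>R (X + Y)) 0"
    by (rule palindrome_expansion[OF X Y], rule that) blast+
  define G where "G s = mat_exp ((-1/2) *\<^sub>R Z s)" for s
  define k where "k s = G s ** mat_exp (s *\<^sub>R X) ** mat_exp (s *\<^sub>R Y)" for s
  have tr: "transpose (mat_exp (t *\<^sub>R A)) = mat_exp (t *\<^sub>R A)" if "A \<in> E" for t A
    using E_Sym[OF that] by (simp add: mat_exp_transpose Sym_def transpose_linear_simps)
  have trG: "transpose (G s) = G s" for s
    unfolding G_def by (rule tr[OF Z(1)])
  have kt: "transpose (k s) = mat_exp (s *\<^sub>R Y) ** mat_exp (s *\<^sub>R X) ** G s" for s
    by (simp add: k_def matrix_transpose_mul tr X Y trG matrix_mul_assoc)
  have YY: "mat_exp (s *\<^sub>R Y) ** mat_exp (s *\<^sub>R Y) = mat_exp (s *\<^sub>R 2 *\<^sub>R Y)" for s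
    using mat_exp_add_scaleR[of s s Y] by (simp add: mult.commute)
  have kk: "k s ** transpose (k s) = mat 1" for s
  proof -
    have "k s ** transpose (k s) = G s ** (mat_exp (s *\<^sub>R X) **
        (mat_exp (s *\<^sub>R Y) ** mat_exp (s *\<^sub>R Y)) ** mat_exp (s *\<^sub>R X)) ** G s"
      unfolding kt by (simp add: k_def matrix_mul_assoc)
    also have "\<dots> = G s ** mat_exp (Z s) ** G s" unfolding YY Z(2) ..
    also have "\<dots> = mat_exp ((-1/2 + 1 + -1/2) *\<^sub>R Z s)"
      unfolding mat_exp_add_scaleR G_def by simp
    finally show ?thesis by simp
  qed
  have kk': "transpose (k s) ** k s = mat 1" for s
    using kk matrix_left_right_inverse by blast
  \<comment> \<open>Conjugating exp(tB) by k is three nested palindromes, with outer factors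
    exp(sY), exp(sX) and exp(-Z/2) from inside out.\<close>
  have conj_E: "k s ** B ** transpose (k s) \<in> E" for s
  proof -
    have "mat_exp (t *\<^sub>R (k s ** B ** transpose (k s))) \<in> M" for t
    proof -
      have "t *\<^sub>R (k s ** B ** transpose (k s)) = k s ** (t *\<^sub>R B) ** transpose (k s)"
        by (simp add: matrix_simps)
      then have "mat_exp (t *\<^sub>R (k s ** B ** transpose (k s))) = k s ** mat_exp (t *\<^sub>R B) ** transpose (k s)"
        using mat_exp_conj[OF kk' kk] by simp
      also have "\<dots> = G s ** (mat_exp (s *\<^sub>R X) ** (mat_exp (s *\<^sub>R Y) ** mat_exp (t *\<^sub>R B) **
          mat_exp (s *\<^sub>R Y)) ** mat_exp (s *\<^sub>R X)) ** G s"
        unfolding kt by (simp add: k_def matrix_mul_assoc)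
      also have "\<dots> \<in> M"
        unfolding G_def by (intro M_conj E_exp X Y B Z(1))
      finally show ?thesis .
    qed
    moreover have "k s ** B ** transpose (k s) \<in> Sym"
      using E_Sym[OF B] by (simp add: Sym_def matrix_transpose_mul matrix_mul_assoc)
    ultimately show ?thesis by (simp add: E_def)
  qed
  let ?K = "(1/2) *\<^sub>R commutator X Y"
  have G: "expands2 G (mat 1) (- (X + Y)) ((1/2) *\<^sub>R ((X + Y) ** (X + Y)))"
    unfolding G_def[abs_def]
    by (rule expands2_eq_rhs[OF expands2_mat_exp[OF expands2_scaleR[OF Z(3), unfolded scaleR_zero_right]]])
       (simp_all add: matrix_simps)
  \<comment> \<open>The first-order terms cancel, and of the quadratic ones only (XY - YX)/2 is
    left.\<close>
  have k: "expands2 k (mat 1) 0 ?K"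
    unfolding k_def[abs_def]
    by (rule expands2_eq_rhs[OF expands2_mult[OF expands2_mult[OF G expands2_exp_ray] expands2_exp_ray]])
       (simp_all add: commutator_def matrix_simps, simp_all add: vec_eq_iff field_simps)
  have Kt: "transpose ?K = - ?K"
    using E_Sym[OF X] E_Sym[OF Y]
    by (simp add: commutator_def Sym_def transpose_linear_simps matrix_transpose_mul flip: scaleR_minus_right)
  \<comment> \<open>The transpose of k contributes -K since K is skew, which turns the second-order
    term K B + B K^T into a commutator.\<close>
  have "expands2 (\<lambda>s. k s ** B ** transpose (k s)) B 0 (commutator ?K B)"
    using expands2_mult[OF expands2_mult[OF k expands2_const[of B]] expands2_transpose[OF k, unfolded Kt]]
    by (simp add: commutator_def[of _ B] matrix_simps transpose_linear_simps)
  then have lim: "((\<lambda>s. (k s ** B ** transpose (k s) - B) /\<^sub>R s\<^sup>2) \<longlongrightarrow> commutator ?K B) (at_right 0)"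
    by (simp add: expands2_def)
  have "commutator ?K B \<in> E"
    by (rule Lim_in_closed_set[OF closed_E _ _ lim])
       (auto intro!: always_eventually subspace_scale[OF subspace_E] subspace_diff[OF subspace_E] conj_E B)
  from E_scale[OF this, of 2] show ?thesis
    by (simp add: commutator_def[of _ B] matrix_simps flip: scaleR_diff_right)
qed

lemma commutator_in_E:
  assumes "X \<in> E" "Y \<in> E"
  shows "commutator X (commutator X Y) \<in> E"
proof -
  have "commutator X (commutator X Y) = - commutator (commutator X Y) X"
    by (simp add: commutator_def)
  with lie_triple[OF assms assms(1)] show ?thesis
    by (simp add: subspace_neg[OF subspace_E])
qed

lemma N_eq: "N = {x ** mat_exp u ** x | u. u \<in> E}"
proof (intro equalityI subsetI)
  fix q assume q: "q \<in> N"
  have eq: "x ** (y ** q ** y) ** x = q" by (simp add: matrix_mul_assoc xy)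
  then have "y ** q ** y \<in> M" using q by (simp add: M_def)
  then obtain u where "u \<in> E" "mat_exp u = y ** q ** y" by (rule M_eq_exp_E)
  with eq show "q \<in> {x ** mat_exp u ** x | u. u \<in> E}" by (intro CollectI exI[of _ u]) simp
next
  fix q assume "q \<in> {x ** mat_exp u ** x | u. u \<in> E}"
  then show "q \<in> N" using E_exp[of _ 1] by (auto simp: M_def)
qed

end

theorem corollary1p2:
  fixes N :: "(real^'n^'n) set"
  assumes "submanifold N"
    and "N \<noteq> {}"
    and "geodesically_complete N"
    and "geodesically_convex N"
  shows "\<exists>x\<in>SPD. \<exists>E. subspace E \<and> E \<subseteq> Sym \<and>
           (\<forall>X\<in>E. \<forall>Y\<in>E. commutator X (commutator X Y) \<in> E) \<and>
           N = {x ** mat_exp u ** x | u. u \<in> E}"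
proof -
  obtain p where p: "p \<in> N" using assms(2) by blast
  then have "p \<in> SPD" using assms(1) by (auto simp: submanifold_def)
  \<comment> \<open>Any point of N may serve as base point; u = 0 then parametrizes that
    point.\<close>
  then obtain x where x: "x \<in> SPD" "x ** x = p" by (rule SPD_sqrt)
  interpret geodesic_set N x "matrix_inv x"
    using assms x p by unfold_locales auto
  show ?thesis
    using x(1) subspace_E E_Sym commutator_in_E N_eq by (intro bexI[of _ x] exI[of _ E]) auto
qed

end
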